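(* Let $n\in\mathbb{N}$, $n\geq 2$, and let $\Omega\subset\mathbb{C}$ be a domain satisfying $\#(\mathbb{C}\setminus\Omega)\geq 2n$. Let $\Psi:S_n(\Omega)\to S_n(\Omega)$ be a holomorphic map such that $\Psi(A)=A$ and $\Psi'(A)=\mathbb{I}$ for some $A\in S_n(\Omega)$. Assume that the matrix $A$ is either diagonalizable or non-derogatory. Then $$\mathbf{c}(\Psi(W))=\mathbf{c}(W)\quad\text{for every } W\in S_n(\Omega).$$ Consequently, for every $W\in S_n(\Omega)$, $\sigma(\Psi(W))=\sigma(W)$ and the algebraic multiplicity of each eigenvalue is preserved, i.e., $\Psi$ is spectrum-preserving on $S_n(\Omega)$.
   Context: $M_n(\mathbb{C})\equiv\mathbb{C}^{n^2}$ is the set of all $n\times n$ complex matrices and $\sigma(W)$ is the set of eigenvalues of $W$. For a domain $\Omega\subset\mathbb{C}$, $S_n(\Omega):=\{W\in M_n(\mathbb{C}):\sigma(W)\subset\Omega\}$, an open connected subset of $M_n(\mathbb{C})$. $\Psi'(A)$ is the complex derivative of $\Psi$ at $A$, a linear map on $M_n(\mathbb{C})$, and $\mathbb{I}$ denotes the identity. The map $\mathbf{c}:M_n(\mathbb{C})\to\mathbb{C}^n$ is $\mathbf{c}(W)=(c_1(W),\dots,c_n(W))$, where $t^n+\sum_{k=1}^n(-1)^k c_k(W)t^{n-k}$ is the characteristic polynomial of $W$. A matrix is non-derogatory if its characteristic polynomial and its minimal polynomial coincide. $\#$ denotes cardinality (possibly infinite). *)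

theory Defs
  imports "HOL-Analysis.Analysis" "HOL-Computational_Algebra.Polynomial"
begin

section \<open>Complex matrices: spectrum, characteristic and minimal polynomial\<close>

type_synonym 'n cmat = "complex ^ 'n ^ 'n"

definition spectrum :: "'n::finite cmat \<Rightarrow> complex set" where
  "spectrum W = {t. \<exists>v. v \<noteq> 0 \<and> W *v v = t *s v}"

text \<open>The determinant is taken over the ring of polynomials: this is \<open>det (t I - W)\<close>.\<close>

definition char_poly :: "'n::finite cmat \<Rightarrow> complex poly" where
  "char_poly W = det (\<chi> i j. (if i = j then [:0, 1:] else 0) - [:W $ i $ j:])"

definition alg_mult :: "'n::finite cmat \<Rightarrow> complex \<Rightarrow> nat" where
  "alg_mult W t = order t (char_poly W)"

text \<open>
  \<open>char_coeff k W\<close> is the number \<open>c\<^sub>k(W)\<close> in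
  \<open>t ^ n + (\<Sum>k = 1..n. (- 1) ^ k * c\<^sub>k(W) * t ^ (n - k))\<close>, the characteristic polynomial,
  and \<open>char_coeffs W\<close> is the \<open>n\<close>-tuple \<open>(c\<^sub>1(W), \<dots>, c\<^sub>n(W))\<close>.
\<close>

definition char_coeff :: "nat \<Rightarrow> 'n::finite cmat \<Rightarrow> complex" where
  "char_coeff k W = (- 1) ^ k * coeff (char_poly W) (CARD('n) - k)"

definition char_coeffs :: "'n::finite cmat \<Rightarrow> complex list" where
  "char_coeffs W = map (\<lambda>k. char_coeff k W) [1..<Suc CARD('n)]"

definition cscale_mat :: "complex \<Rightarrow> 'n::finite cmat \<Rightarrow> 'n cmat" where
  "cscale_mat c W = (\<chi> i j. c * W $ i $ j)"

text \<open>
  The class operations \<open>*\<close> and \<open>^\<close> on type \<open>vec\<close> act componentwise, so powers with respect to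
  the matrix product \<open>**\<close> are defined separately.
\<close>

definition mat_power :: "'n::finite cmat \<Rightarrow> nat \<Rightarrow> 'n cmat" where
  "mat_power W k = (((**) W) ^^ k) (mat 1)"

definition poly_mat :: "complex poly \<Rightarrow> 'n::finite cmat \<Rightarrow> 'n cmat" where
  "poly_mat p W = (\<Sum>k\<le>degree p. cscale_mat (coeff p k) (mat_power W k))"

definition is_minimal_poly :: "complex poly \<Rightarrow> 'n::finite cmat \<Rightarrow> bool" where
  "is_minimal_poly p W \<longleftrightarrow>
     lead_coeff p = 1 \<and> poly_mat p W = 0 \<and>
     (\<forall>q. lead_coeff q = 1 \<and> poly_mat q W = 0 \<longrightarrow> degree p \<le> degree q)"

definition non_derogatory :: "'n::finite cmat \<Rightarrow> bool" where
  "non_derogatory W \<longleftrightarrow> is_minimal_poly (char_poly W) W"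

definition diagonalizable :: "'n::finite cmat \<Rightarrow> bool" where
  "diagonalizable W \<longleftrightarrow>
     (\<exists>P D :: 'n cmat. invertible P \<and> (\<forall>i j. i \<noteq> j \<longrightarrow> D $ i $ j = 0) \<and> W = P ** D ** matrix_inv P)"


section \<open>Holomorphic maps on sets of matrices\<close>

definition spectral_set :: "complex set \<Rightarrow> 'n::finite cmat set" where
  "spectral_set \<Omega> = {W. spectrum W \<subseteq> \<Omega>}"

text \<open>
  \<open>has_derivative\<close> is the Frechet derivative of the underlying real normed space and makes \<open>D\<close>
  real-linear; the second conjunct makes it complex-linear.
\<close>

definition has_complex_derivative ::
    "('n::finite cmat \<Rightarrow> 'n cmat) \<Rightarrow> ('n cmat \<Rightarrow> 'n cmat) \<Rightarrow> 'n cmat filter \<Rightarrow> bool"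
    (infix "has'_complex'_derivative" 50) where
  "(F has_complex_derivative D) net \<longleftrightarrow>
     (F has_derivative D) net \<and> (\<forall>c X. D (cscale_mat c X) = cscale_mat c (D X))"

definition holomorphic_map_on :: "('n::finite cmat \<Rightarrow> 'n cmat) \<Rightarrow> 'n cmat set \<Rightarrow> bool"
    (infix "holomorphic'_map'_on" 50) where
  "F holomorphic_map_on S \<longleftrightarrow> (\<forall>W\<in>S. \<exists>D. (F has_complex_derivative D) (at W within S))"

end

theory Submission
  imports Defs "HOL-Complex_Analysis.Great_Picard"
begin

text \<open>
  Write \<open>p\<^sub>W\<close> for the characteristic polynomial of \<open>W\<close>, \<open>n\<close> for the size of the matrices and
  \<open>S\<close> for \<open>spectral_set \<Omega>\<close>. It is enough to show \<open>p\<^sub>W(a) = p\<^sub>Z(a)\<close>, where \<open>Z = \<Psi> W\<close>, for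
  \<open>2n\<close> points \<open>a\<close> outside \<open>\<Omega>\<close>. The argument is Cartan's: since \<open>\<Psi>\<close> is tangent to the identity
  at its fixed point \<open>A\<close>, the lowest-order term of \<open>E(W) = p\<^sub>Z(a) - p\<^sub>W(a)\<close> at \<open>A\<close> is not changed
  when \<open>E\<close> is composed with an iterate of \<open>\<Psi>\<close>. The sum of \<open>E \<circ> \<Psi>\<^sup>l\<close> over \<open>l < k\<close> telescopes
  to the difference of characteristic polynomials for \<open>\<Psi>\<^sup>k\<close>, and its lowest-order term is
  \<open>k\<close> times that of \<open>E\<close>. So if these differences stay bounded near \<open>A\<close> uniformly in \<open>k\<close>, then
  \<open>E\<close> has no lowest-order term, and \<open>E = 0\<close> near \<open>A\<close> (\<open>vanishing_of_bounded_orbit_sums\<close>). As \<open>S\<close> is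
  open and connected, \<open>E\<close> vanishes on all of \<open>S\<close>. Only the characteristic polynomials of the
  iterates have to be bounded, not the iterates themselves.

  The uniform bound is where the complement of \<open>\<Omega>\<close> enters. Along a complex line through \<open>A\<close> the
  \<open>2n\<close> numbers \<open>p(a)\<close>, with \<open>p\<close> the characteristic polynomial of the image, are zero-free
  holomorphic functions of the parameter. Together with the constant \<open>1\<close> they
  form \<open>2n + 1\<close> functions of which any \<open>n + 2\<close> satisfy a linear relation with nonzero constant
  coefficients, because \<open>p\<close> is monic of degree \<open>n\<close> (divided differences). In a linear relation the
  largest term cannot be much larger than all the others, so at every point at least \<open>n + 1\<close> of the
  \<open>2n + 1\<close> functions, a strict majority, have a modulus comparable to the largest one
  (\<open>majority_of_monic_values\<close>). Geometrically, the maps go to the complement of \<open>2n + 1\<close>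
  hyperplanes in general position in projective \<open>n\<close>-space, which is hyperbolic.

  The required Schottky theorem (\<open>schottky_majority\<close>) is proved for logarithms \<open>g\<^sub>i\<close> of such
  functions. If it failed, one could rescale at points where the derivatives of the
  differences \<open>g\<^sub>i - g\<^sub>j\<close> are
  much larger than the real parts, and divide by the size of the real parts. Because the
  tolerance in "comparable" is additive for the logarithms, it disappears in the limit:
  at each point a strict majority of the limits \<open>G\<^sub>i\<close> have exactly the maximal real part. Two strict
  majorities meet, so by the identity theorem a single \<open>G\<^sub>s\<close> is maximal everywhere
  (\<open>majority_leader\<close>). Then \<open>Re (G\<^sub>s - G\<^sub>j) \<ge> 0\<close> on a large disc, which makes the derivatives of
  \<open>G\<^sub>s - G\<^sub>j\<close> at the centre small, against the normalisation of the rescaling.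
\<close>

section \<open>Rescaling, growth and compactness for families of holomorphic functions\<close>

text \<open>
  Zalcman's choice of a centre. Maximising \<open>(r - |z|) s(z) / h(z)\<close> instead of \<open>s(z) / h(z)\<close>
  keeps the maximum away from the boundary, so that on a disc around it, whose radius is \<open>R\<close> in the
  natural unit \<open>\<rho> = h(z) / s(z)\<close>, the quotient \<open>s / h\<close> is at most twice its value at the centre.
\<close>

lemma rescaling_point:
  fixes s h :: "complex \<Rightarrow> real"
  assumes cont: "continuous_on (cball 0 r) s" "continuous_on (cball 0 r) h"
    and h: "\<And>x. x \<in> cball 0 r \<Longrightarrow> 0 < h x" and s: "\<And>x. x \<in> cball 0 r \<Longrightarrow> 0 \<le> s x"
    and r: "0 < r" and R: "0 < R"
    and w: "w \<in> cball 0 (r / 2)" "4 * R * h w < r * s w"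
  obtains z \<rho> where "0 < \<rho>" "cball z (\<rho> * R) \<subseteq> ball 0 r" "\<rho> * s z = h z"
    "\<And>x. x \<in> cball z (\<rho> * R) \<Longrightarrow> \<rho> * s x \<le> 2 * h x"
proof -
  define \<phi> where "\<phi> x = (r - norm x) * s x / h x" for x
  have "continuous_on (cball 0 r) \<phi>"
    unfolding \<phi>_def using cont h by (intro continuous_intros) force+
  then obtain z where z: "z \<in> cball 0 r" and zmax: "\<And>x. x \<in> cball 0 r \<Longrightarrow> \<phi> x \<le> \<phi> z"
    using continuous_attains_sup[of "cball 0 r" \<phi>] r by fastforce
  have w': "w \<in> cball 0 r" using w r by auto
  have "2 * R < \<phi> w"
  proof -
    have "2 * R * h w < (r / 2) * s w" using w by simp
    also have "\<dots> \<le> (r - norm w) * s w"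
      using w s[OF w'] by (intro mult_right_mono) auto
    finally show ?thesis using h[OF w'] by (simp add: \<phi>_def field_simps)
  qed
  with zmax[OF w'] have big: "2 * R < \<phi> z" by simp
  have hz: "0 < h z" using h z by blast
  have "\<phi> z > 0" using big R by simp
  then have "(r - norm z) * s z > 0" using hz by (simp add: \<phi>_def zero_less_divide_iff)
  then have zr: "norm z < r" and sz: "0 < s z"
    using s[OF z] z by (auto simp: zero_less_mult_iff)
  define \<rho> where "\<rho> = h z / s z"
  have \<rho>: "0 < \<rho>" using hz sz by (simp add: \<rho>_def)
  have phiz: "\<phi> z = (r - norm z) / \<rho>" by (simp add: \<phi>_def \<rho>_def)
  have half: "\<rho> * R < (r - norm z) / 2"
    using big \<rho> by (simp add: phiz field_simps)
  have far: "(r - norm z) / 2 < r - norm x" if "x \<in> cball z (\<rho> * R)" for x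
  proof -
    have "norm x \<le> norm z + \<rho> * R"
      using that norm_triangle_sub[of x z] by (simp add: dist_norm norm_minus_commute)
    then show ?thesis using half by simp
  qed
  have sub: "cball z (\<rho> * R) \<subseteq> ball 0 r"
  proof
    fix x assume "x \<in> cball z (\<rho> * R)"
    from far[OF this] show "x \<in> ball 0 r" using zr by simp
  qed
  show ?thesis
  proof
    show "\<rho> * s z = h z" using sz by (simp add: \<rho>_def)
    fix x assume x: "x \<in> cball z (\<rho> * R)"
    then have x': "x \<in> cball 0 r" using sub by auto
    have "(r - norm z) / 2 * (s x / h x) \<le> (r - norm x) * (s x / h x)"
      using far[OF x] s[OF x'] h[OF x'] by (intro mult_right_mono) auto
    also have "\<dots> \<le> (r - norm z) / \<rho>" using zmax[OF x'] phiz[symmetric] by (simp add: \<phi>_def)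
    finally have "(r - norm z) * (s x / h x / 2) \<le> (r - norm z) * (1 / \<rho>)" by simp
    then have "s x / h x / 2 \<le> 1 / \<rho>" using zr by (simp only: mult_le_cancel_left_pos diff_gt_0_iff_gt)
    then have "\<rho> * (s x / h x) \<le> 2" using \<rho> by (simp add: field_simps)
    then show "\<rho> * s x \<le> 2 * h x" using h[OF x'] by (simp add: field_simps)
  qed (use \<rho> sub in auto)
qed

text \<open>
  A Gronwall inequality along the segment from \<open>0\<close> to \<open>x\<close>. The real parts control the
  derivatives, hence also their own growth.
\<close>

lemma gronwall_holomorphic_family:
  fixes f :: "'p \<Rightarrow> complex \<Rightarrow> complex" and K A R :: real
  assumes P: "finite P" and hol: "\<And>p. p \<in> P \<Longrightarrow> f p holomorphic_on ball 0 R"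
    and pos: "0 < K" "0 < A" "0 < R"
    and bd: "\<And>p x. p \<in> P \<Longrightarrow> x \<in> ball 0 R \<Longrightarrow>
               norm (deriv (f p) x) \<le> K * (A + (\<Sum>q\<in>P. \<bar>Re (f q x)\<bar>))"
    and x: "x \<in> ball 0 R"
  shows "A + (\<Sum>p\<in>P. \<bar>Re (f p x)\<bar>) \<le>
         2 * exp (2 * card P * K * R) * (A + (\<Sum>p\<in>P. \<bar>Re (f p 0)\<bar>))"
proof (cases "P = {}")
  case True
  then show ?thesis using pos by simp
next
  case False
  define c where "c = 2 * card P * K * R"
  have c: "0 < c" using False P pos by (simp add: c_def card_gt_0_iff)
  define y where "y t = A + (\<Sum>p\<in>P. \<bar>Re (f p (of_real t * x))\<bar>)" for t :: real
  have seg: "of_real t * x \<in> ball 0 R" if "0 \<le> t" "t \<le> 1" for t :: real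
  proof -
    have "t * norm x \<le> 1 * norm x" using that by (intro mult_right_mono) auto
    then show ?thesis using x that by (simp add: norm_mult)
  qed
  have contf: "continuous_on {0..1} (\<lambda>t::real. f p (of_real t * x))" if "p \<in> P" for p
  proof (rule continuous_on_compose2[OF holomorphic_on_imp_continuous_on[OF hol[OF that]]])
    show "continuous_on {0..1} (\<lambda>t::real. of_real t * x)" by (intro continuous_intros)
    show "(\<lambda>t::real. of_real t * x) ` {0..1} \<subseteq> ball 0 R"
    proof (rule image_subsetI)
      fix t :: real assume "t \<in> {0..1}"
      then show "of_real t * x \<in> ball 0 R" by (intro seg) simp_all
    qed
  qed
  \<comment> \<open>Since \<open>c\<close> is twice the rate at which \<open>y\<close> can grow, integrating up to the point \<open>t0\<close> where
    the damped function is maximal costs only half of that maximum.\<close>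
  have "continuous_on {0..1} (\<lambda>t. y t * exp (- c * t))"
    unfolding y_def using contf by (intro continuous_intros) auto
  from continuous_attains_sup[OF compact_Icc _ this] obtain t0 where t0: "t0 \<in> {0..1}"
    and t0max: "\<And>t. t \<in> {0..1} \<Longrightarrow> y t * exp (- c * t) \<le> y t0 * exp (- c * t0)"
    by (metis atLeastAtMost_iff empty_iff order_refl zero_le_one)
  define Q where "Q = y t0 * exp (- c * t0)"
  have yQ: "y t \<le> Q * exp (c * t)" if "t \<in> {0..1}" for t
    using t0max[OF that] by (simp add: Q_def exp_minus field_simps)
  have y0: "y t > 0" for t using pos by (simp add: y_def add_pos_nonneg sum_nonneg)
  have Qpos: "Q > 0" by (simp add: Q_def y0)
  have "Q \<le> 2 * y 0"
  proof (cases "t0 = 0")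
    case True
    then show ?thesis using y0[of 0] by (simp add: Q_def)
  next
    case False
    then have t0': "0 < t0" "t0 \<le> 1" using t0 by auto
    define b where "b = K * R * Q / c"
    have b: "b > 0" using pos c Qpos by (simp add: b_def)
    have step: "norm (f p (of_real t0 * x) - f p (of_real 0 * x)) \<le> b * exp (c * t0) - b * exp (c * 0)"
      if p: "p \<in> P" for p
    proof (rule differentiable_bound_general[where f = "\<lambda>t. f p (of_real t * x)" and \<phi> = "\<lambda>t. b * exp (c * t)"
            and f' = "\<lambda>t. deriv (f p) (of_real t * x) * x" and \<phi>' = "\<lambda>t. K * (Q * exp (c * t)) * R"])
      show "continuous_on {0..t0} (\<lambda>t. f p (of_real t * x))"
        by (rule continuous_on_subset[OF contf[OF p]]) (use t0 in auto)
      show "continuous_on {0..t0} (\<lambda>t. b * exp (c * t))" by (intro continuous_intros)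
      fix t assume t: "0 < t" "t < t0"
      then have sg: "of_real t * x \<in> ball 0 R" using t0' by (intro seg) auto
      have d1: "(f p has_field_derivative deriv (f p) (of_real t * x)) (at (of_real t * x))"
        using holomorphic_derivI[OF hol[OF p] open_ball sg] .
      have d2: "((\<lambda>t. of_real t * x) has_vector_derivative x) (at t)"
        by (auto intro!: derivative_eq_intros)
      show "((\<lambda>t. f p (of_real t * x)) has_vector_derivative deriv (f p) (of_real t * x) * x) (at t)"
        using field_vector_diff_chain_at[OF d2 d1] by (simp add: o_def mult.commute)
      show "((\<lambda>t. b * exp (c * t)) has_vector_derivative K * (Q * exp (c * t)) * R) (at t)"
        using c by (auto simp: b_def simp flip: has_real_derivative_iff_has_vector_derivative intro!: derivative_eq_intros)
      have "norm (deriv (f p) (of_real t * x) * x) \<le> (K * y t) * R"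
        unfolding norm_mult using bd[OF p sg] x pos y0[of t]
        by (intro mult_mono) (auto simp: y_def)
      also have "\<dots> \<le> K * (Q * exp (c * t)) * R"
        using yQ[of t] pos t t0' by (intro mult_right_mono mult_left_mono) auto
      finally show "norm (deriv (f p) (of_real t * x) * x) \<le> K * (Q * exp (c * t)) * R" .
    qed (use t0' in auto)
    have "\<bar>Re (f p (of_real t0 * x))\<bar> \<le> \<bar>Re (f p 0)\<bar> + b * exp (c * t0)" if "p \<in> P" for p
    proof -
      have "\<bar>Re (f p (of_real t0 * x) - f p 0)\<bar> \<le> b * exp (c * t0)"
        using step[OF that] b abs_Re_le_cmod[of "f p (of_real t0 * x) - f p 0"] by simp
      then show ?thesis by simp
    qed
    then have "y t0 \<le> A + (\<Sum>p\<in>P. \<bar>Re (f p 0)\<bar> + b * exp (c * t0))"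
      unfolding y_def by (intro add_left_mono sum_mono)
    also have "\<dots> = y 0 + card P * b * exp (c * t0)"
      by (simp add: y_def sum.distrib)
    also have "card P * b = Q / 2" using c pos \<open>P \<noteq> {}\<close> P by (simp add: b_def c_def)
    finally have "y t0 * exp (- c * t0) \<le> (y 0 + Q / 2 * exp (c * t0)) * exp (- c * t0)"
      by (intro mult_right_mono) auto
    also have "\<dots> = y 0 * exp (- c * t0) + Q / 2" by (simp add: exp_minus field_simps)
    also have "y 0 * exp (- c * t0) \<le> y 0 * 1"
      using c t0' y0[of 0] by (intro mult_left_mono) auto
    finally show ?thesis by (simp add: Q_def)
  qed
  then have "y 1 \<le> 2 * y 0 * exp (c * 1)"
    using yQ[of 1] by (smt (verit, ccfv_SIG) atLeastAtMost_iff exp_ge_zero mult_right_mono zero_le_one)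
  then show ?thesis by (simp add: y_def c_def algebra_simps)
qed

text \<open>
  Harnack's inequality in infinitesimal form: the Schwarz lemma for \<open>f\<close> followed by
  the Cayley map of the right half plane to the disc that sends \<open>f 0\<close> to \<open>0\<close>.
\<close>

lemma deriv_bound_of_Re_nonneg:
  assumes hol: "f holomorphic_on ball 0 R" and R: "0 < R"
    and pos: "\<And>z. z \<in> ball 0 R \<Longrightarrow> 0 \<le> Re (f z)"
  shows "norm (deriv f 0) * R \<le> 2 * Re (f 0)"
proof -
  have "norm (deriv f 0) * R \<le> 2 * Re (f 0) + e" if e: "e > 0" for e
  proof -
    \<comment> \<open>The shift by \<open>e / 2\<close> makes the real part positive, so that the Cayley map has no pole.\<close>
    define a where "a = f 0 + of_real (e / 2)"
    have a: "Re a > 0" using pos[of 0] R e by (simp add: a_def)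
    define u where "u z = f (of_real R * z) + of_real (e / 2)" for z
    define w where "w z = (u z - a) / (u z + cnj a)" for z
    have u: "Re (u z) > 0" if "norm z < 1" for z
      using pos[of "of_real R * z"] that R e by (simp add: u_def norm_mult)
    have den: "u z + cnj a \<noteq> 0" if "norm z < 1" for z
      using u[OF that] a by (metis add_pos_pos cnj.simps(1) less_irrefl plus_complex.simps(1) zero_complex.simps(1))
    have holu: "u holomorphic_on ball 0 1"
      unfolding u_def
      by (intro holomorphic_intros holomorphic_on_compose_gen[OF _ hol, unfolded o_def])
        (use R in \<open>auto simp: norm_mult intro!: holomorphic_intros\<close>)
    have holw: "w holomorphic_on ball 0 1"
      unfolding w_def using den by (intro holomorphic_intros holu) auto
    have w1: "norm (w z) < 1" if z: "norm z < 1" for z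
    proof -
      have "(norm (u z - a))\<^sup>2 < (norm (u z + cnj a))\<^sup>2"
        using mult_pos_pos[OF u[OF z] a] unfolding cmod_power2
        by (simp add: power2_eq_square algebra_simps)
      then have "norm (u z - a) < norm (u z + cnj a)"
        by (rule power_less_imp_less_base) simp
      then show ?thesis using den[OF z] by (simp add: w_def norm_divide)
    qed
    have "u 0 = a" by (simp add: u_def a_def)
    then have "w 0 = 0" by (simp add: w_def)
    from Schwarz_Lemma(2)[OF holw this w1, of 0] have S: "norm (deriv w 0) \<le> 1" by simp
    have du: "(u has_field_derivative deriv f 0 * of_real R) (at 0)"
    proof -
      have "(f has_field_derivative deriv f 0) (at (of_real R * 0))"
        using holomorphic_derivI[OF hol open_ball, of 0] R by simp
      then have "((\<lambda>z. f (of_real R * z)) has_field_derivative deriv f 0 * of_real R) (at 0)"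
        by (rule DERIV_chain2) (auto intro!: derivative_eq_intros)
      then show ?thesis unfolding u_def by (auto intro!: derivative_eq_intros)
    qed
    have "(w has_field_derivative (deriv f 0 * of_real R * (u 0 + cnj a) - (u 0 - a) * (deriv f 0 * of_real R)) / ((u 0 + cnj a) * (u 0 + cnj a))) (at 0)"
      unfolding w_def using den[of 0] by (auto intro!: derivative_eq_intros du)
    then have "deriv w 0 = (deriv f 0 * of_real R * (u 0 + cnj a)) / ((u 0 + cnj a) * (u 0 + cnj a))"
      using \<open>u 0 = a\<close> by (simp add: DERIV_imp_deriv)
    also have "\<dots> = deriv f 0 * of_real R / (u 0 + cnj a)" using den[of 0] by simp
    also have "u 0 + cnj a = of_real (2 * Re a)" using \<open>u 0 = a\<close> by (simp add: complex_add_cnj)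
    finally have "norm (deriv f 0) * R / (2 * Re a) \<le> 1"
      using S R a by (simp add: norm_mult norm_divide)
    then show ?thesis using a by (simp add: a_def)
  qed
  then show ?thesis by (rule field_le_epsilon)
qed

text \<open>
  Montel's theorem with one subsequence for all members of the family; the derivatives are
  included because the rescaled functions are normalised by a derivative.
\<close>

lemma Montel_finite_family:
  fixes f :: "nat \<Rightarrow> 'i \<Rightarrow> complex \<Rightarrow> complex"
  assumes I: "finite I" and S: "open S"
    and hol: "\<And>k i. i \<in> I \<Longrightarrow> f k i holomorphic_on S"
    and bd: "\<And>k i z. i \<in> I \<Longrightarrow> z \<in> S \<Longrightarrow> norm (f k i z) \<le> B"
  shows "\<exists>r G. strict_mono (r :: nat \<Rightarrow> nat) \<and> (\<forall>i\<in>I. G i holomorphic_on S \<and>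
           (\<forall>z\<in>S. (\<lambda>k. f (r k) i z) \<longlonglongrightarrow> G i z \<and> (\<lambda>k. deriv (f (r k) i) z) \<longlonglongrightarrow> deriv (G i) z))"
  using I hol bd
proof (induction I)
  case empty
  show ?case by (auto intro!: exI[of _ id] strict_mono_id)
next
  case (insert j I)
  have "\<exists>r G. strict_mono (r :: nat \<Rightarrow> nat) \<and> (\<forall>i\<in>I. G i holomorphic_on S \<and>
           (\<forall>z\<in>S. (\<lambda>k. f (r k) i z) \<longlonglongrightarrow> G i z \<and> (\<lambda>k. deriv (f (r k) i) z) \<longlonglongrightarrow> deriv (G i) z))"
    by (rule insert.IH) (use insert.prems in auto)
  then obtain r G where r: "strict_mono (r :: nat \<Rightarrow> nat)"
    and G: "\<And>i. i \<in> I \<Longrightarrow> G i holomorphic_on S"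
      "\<And>i z. i \<in> I \<Longrightarrow> z \<in> S \<Longrightarrow> (\<lambda>k. f (r k) i z) \<longlonglongrightarrow> G i z"
      "\<And>i z. i \<in> I \<Longrightarrow> z \<in> S \<Longrightarrow> (\<lambda>k. deriv (f (r k) i) z) \<longlonglongrightarrow> deriv (G i) z"
    by blast
  obtain g q where g: "g holomorphic_on S" "strict_mono (q :: nat \<Rightarrow> nat)"
      "\<And>x. x \<in> S \<Longrightarrow> ((\<lambda>n. f (r (q n)) j x) \<longlonglongrightarrow> g x)"
      "\<And>K. \<lbrakk>compact K; K \<subseteq> S\<rbrakk> \<Longrightarrow> uniform_limit K ((\<lambda>k. f (r k) j) \<circ> q) g sequentially"
  proof (rule Montel[OF S, where \<H> = "range (\<lambda>k. f (r k) j)" and \<F> = "\<lambda>k. f (r k) j"])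
    show "\<exists>B. \<forall>h\<in>range (\<lambda>k. f (r k) j). \<forall>z\<in>K. norm (h z) \<le> B" if "compact K" "K \<subseteq> S" for K
      using insert.prems(2)[of j] that by blast
  qed (use insert.prems in auto)
  have dg: "(\<lambda>k. deriv (f (r (q k)) j) z) \<longlonglongrightarrow> deriv g z" if z: "z \<in> S" for z
  proof -
    obtain e where e: "e > 0" "cball z e \<subseteq> S" using S z open_contains_cball by blast
    have "(\<lambda>k. (deriv ^^ 1) (f (r (q k)) j) z) \<longlonglongrightarrow> (deriv ^^ 1) g z"
    proof (rule higher_deriv_complex_uniform_limit[where A = "ball z e"])
      show "uniform_limit (ball z e) (\<lambda>k. f (r (q k)) j) g sequentially"
        using uniform_limit_on_subset[OF g(4)[OF compact_cball e(2)] ball_subset_cball] by (simp add: o_def)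
      show "\<forall>\<^sub>F k in sequentially. f (r (q k)) j holomorphic_on ball z e"
        using holomorphic_on_subset[OF insert.prems(1)[OF insertI1] order_trans[OF ball_subset_cball e(2)]]
        by (intro always_eventually allI)
    qed (use e in auto)
    then show ?thesis by simp
  qed
  have "strict_mono (\<lambda>k. r (q k))" using r g(2) by (simp add: strict_mono_def)
  moreover have "(\<lambda>k. f (r (q k)) i z) \<longlonglongrightarrow> G i z" "(\<lambda>k. deriv (f (r (q k)) i) z) \<longlonglongrightarrow> deriv (G i) z"
    if "i \<in> I" "z \<in> S" for i z
    using LIMSEQ_subseq_LIMSEQ[OF G(2)[OF that] g(2)] LIMSEQ_subseq_LIMSEQ[OF G(3)[OF that] g(2)]
    by (simp_all add: o_def)
  ultimately show ?case
    using G(1) g dg insert.hyps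
    by (intro exI[of _ "\<lambda>k. r (q k)"] exI[of _ "G(j := g)"]) auto
qed

section \<open>A Schottky theorem for families with a near-maximal majority\<close>

text \<open>
  For real parts of logarithms, the tolerance \<open>C\<close> is a multiplicative constant for the moduli.
\<close>

definition near_max :: "real \<Rightarrow> 'i set \<Rightarrow> ('i \<Rightarrow> real) \<Rightarrow> 'i set" where
  "near_max C I x = {i \<in> I. \<forall>j\<in>I. x j \<le> x i + C}"

definition majority_near_max :: "real \<Rightarrow> 'i set \<Rightarrow> ('i \<Rightarrow> real) \<Rightarrow> bool" where
  "majority_near_max C I x \<longleftrightarrow> card I < 2 * card (near_max C I x)"

lemma near_max_subset: "near_max C I x \<subseteq> I"
  by (auto simp: near_max_def)

lemma two_majorities_meet:
  assumes "finite I" "majority_near_max C I x" "majority_near_max C' I y"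
  shows "near_max C I x \<inter> near_max C' I y \<noteq> {}"
proof
  assume disj: "near_max C I x \<inter> near_max C' I y = {}"
  have fin: "finite (near_max C I x)" "finite (near_max C' I y)"
    by (simp_all add: finite_subset[OF near_max_subset assms(1)])
  have "card (near_max C I x) + card (near_max C' I y) = card (near_max C I x \<union> near_max C' I y)"
    using card_Un_disjoint[OF fin disj] by simp
  also have "\<dots> \<le> card I"
    by (intro card_mono assms Un_least near_max_subset)
  finally show False using assms(2,3) by (simp add: majority_near_max_def)
qed

text \<open>
  An identity theorem for harmonic functions. A nonconstant holomorphic function is open, so its
  image of an open set does not fit into the imaginary axis.
\<close>

lemma Re_nonzero_somewhere:
  assumes hol: "f holomorphic_on S" and S: "open S" "connected S"
    and z: "z \<in> S" "Re (f z) \<noteq> 0" and V: "open V" "V \<noteq> {}" "V \<subseteq> S"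
  shows "\<exists>v\<in>V. Re (f v) \<noteq> 0"
proof (rule ccontr)
  assume "\<not> ?thesis"
  then have zero: "\<And>v. v \<in> V \<Longrightarrow> Re (f v) = 0" by blast
  show False
  proof (cases "f constant_on S")
    case True
    then obtain c where "\<And>x. x \<in> S \<Longrightarrow> f x = c" by (auto simp: constant_on_def)
    with zero z V show False by (metis equals0I subsetD)
  next
    case False
    then have op: "open (f ` V)" using open_mapping_thm[OF hol S V(1,3)] by blast
    obtain v where v: "v \<in> V" using V by blast
    then obtain e where e: "e > 0" "ball (f v) e \<subseteq> f ` V" using op open_contains_ball by blast
    have "f v + of_real (e / 2) \<in> f ` V" using e by (intro subsetD[OF e(2)]) (simp add: dist_norm)
    then obtain x where x: "x \<in> V" "f v + of_real (e / 2) = f x" by blast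
    from zero[OF x(1)] have "Re (f v + of_real (e / 2)) = 0" unfolding x(2) .
    then show False using zero[OF v] e(1) by simp
  qed
qed

lemma avoid_zeros_of_Re:
  fixes f :: "'p \<Rightarrow> complex \<Rightarrow> complex"
  assumes P: "finite P" and S: "open S" "connected S"
    and hol: "\<And>p. p \<in> P \<Longrightarrow> f p holomorphic_on S" and nz: "\<And>p. p \<in> P \<Longrightarrow> \<exists>z\<in>S. Re (f p z) \<noteq> 0"
    and V: "open V" "V \<noteq> {}" "V \<subseteq> S"
  shows "\<exists>v\<in>V. \<forall>p\<in>P. Re (f p v) \<noteq> 0"
  using P hol nz V
proof (induction P arbitrary: V)
  case empty
  then show ?case by blast
next
  case (insert q P)
  obtain z where "z \<in> S" "Re (f q z) \<noteq> 0" using insert.prems by blast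
  then obtain v where v: "v \<in> V" "Re (f q v) \<noteq> 0"
    using Re_nonzero_somewhere[of "f q" S z V] insert.prems S by auto
  define V' where "V' = {x \<in> V. Re (f q x) \<noteq> 0}"
  have "continuous_on V (\<lambda>x. Re (f q x))"
    using holomorphic_on_imp_continuous_on[OF holomorphic_on_subset[OF insert.prems(1)[OF insertI1] insert.prems(5)]]
    by (rule continuous_on_Re)
  then have "open V'"
    using continuous_open_preimage[of V "\<lambda>x. Re (f q x)" "- {0}"] insert.prems(3)
    by (auto simp: V'_def vimage_def Int_def)
  then have "\<exists>v\<in>V'. \<forall>p\<in>P. Re (f p v) \<noteq> 0"
    using v insert.prems by (intro insert.IH) (auto simp: V'_def)
  then show ?case by (auto simp: V'_def)
qed

text \<open>
  Off the zero sets of the finitely many functions \<open>Re (G\<^sub>i - G\<^sub>j)\<close> that do not vanish identically,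
  all indices of maximal real part have the same real part everywhere. Any two of the majorities
  meet, so the same class is on top at all these points, and they are dense.
\<close>

lemma majority_leader:
  fixes G :: "'i \<Rightarrow> complex \<Rightarrow> complex"
  assumes I: "finite I" and S: "open S" "connected S" "S \<noteq> {}"
    and hol: "\<And>i. i \<in> I \<Longrightarrow> G i holomorphic_on S"
    and maj: "\<And>z. z \<in> S \<Longrightarrow> majority_near_max 0 I (\<lambda>i. Re (G i z))"
  obtains s where "s \<in> I" "\<And>j z. j \<in> I \<Longrightarrow> z \<in> S \<Longrightarrow> Re (G j z) \<le> Re (G s z)"
proof -
  define M where "M z = near_max 0 I (\<lambda>i. Re (G i z))" for z
  define P where "P = {p \<in> I \<times> I. \<exists>z\<in>S. Re (G (fst p) z) \<noteq> Re (G (snd p) z)}"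
  have dense: "\<exists>v\<in>V. \<forall>p\<in>P. Re (G (fst p) v - G (snd p) v) \<noteq> 0"
    if "open V" "V \<noteq> {}" "V \<subseteq> S" for V
  proof (rule avoid_zeros_of_Re[OF _ S(1,2) _ _ that])
    show "finite P" unfolding P_def using I by auto
    show "(\<lambda>z. G (fst p) z - G (snd p) z) holomorphic_on S" if "p \<in> P" for p
      using that hol by (intro holomorphic_intros) (auto simp: P_def)
    show "\<exists>z\<in>S. Re (G (fst p) z - G (snd p) z) \<noteq> 0" if "p \<in> P" for p
      using that by (auto simp: P_def)
  qed
  obtain z0 where z0: "z0 \<in> S" "\<And>p. p \<in> P \<Longrightarrow> Re (G (fst p) z0 - G (snd p) z0) \<noteq> 0"
    using dense[OF S(1,3)] by blast
  have "M z0 \<noteq> {}" using two_majorities_meet[OF I maj maj] z0(1) by (auto simp: M_def)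
  then obtain s where s: "s \<in> M z0" by blast
  then have sI: "s \<in> I" by (simp add: M_def near_max_def)
  have top: "Re (G j z) \<le> Re (G s z)"
    if z: "z \<in> S" "\<And>p. p \<in> P \<Longrightarrow> Re (G (fst p) z - G (snd p) z) \<noteq> 0" and j: "j \<in> I" for z j
  proof -
    obtain i where i: "i \<in> M z0" "i \<in> M z"
      using two_majorities_meet[OF I maj[OF z0(1)] maj[OF z(1)]] by (auto simp: M_def)
    then have "i \<in> I" "Re (G i z0) = Re (G s z0)"
      using s by (auto simp: M_def near_max_def intro: antisym)
    then have "(i, s) \<notin> P" using z0(2)[of "(i, s)"] by auto
    then have "Re (G i z) = Re (G s z)" using \<open>i \<in> I\<close> sI z(1) by (auto simp: P_def)
    then show ?thesis using i(2) j by (auto simp: M_def near_max_def)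
  qed
  show ?thesis
  proof (rule that[OF sI], rule ccontr)
    fix j z assume j: "j \<in> I" and z: "z \<in> S" and "\<not> Re (G j z) \<le> Re (G s z)"
    define V where "V = {x \<in> S. Re (G j x - G s x) > 0}"
    have "continuous_on S (\<lambda>x. Re (G j x - G s x))"
      using hol[OF j] hol[OF sI]
      by (intro continuous_intros holomorphic_on_imp_continuous_on)
    then have "open V"
      using continuous_open_preimage[of S "\<lambda>x. Re (G j x - G s x)" "{0<..}"] S(1)
      by (auto simp: V_def vimage_def Int_def)
    moreover have "z \<in> V" using z \<open>\<not> Re (G j z) \<le> Re (G s z)\<close> by (simp add: V_def)
    ultimately obtain v where "v \<in> V" "\<And>p. p \<in> P \<Longrightarrow> Re (G (fst p) v - G (snd p) v) \<noteq> 0"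
      using dense[of V] by (auto simp: V_def)
    then show False using top[of v j] j by (simp add: V_def)
  qed
qed

text \<open>
  An index that is not maximal in the limit is eventually beaten by more than \<open>\<epsilon> k\<close>. As the index
  set is finite, the near-maximal set of some \<open>x k\<close> is contained in the maximal set of the limit.
\<close>

lemma majority_near_max_limit:
  assumes I: "finite I" and maj: "\<And>k. majority_near_max (\<epsilon> k) I (x k)"
    and \<epsilon>: "\<epsilon> \<longlonglongrightarrow> 0" and x: "\<And>i. i \<in> I \<Longrightarrow> (\<lambda>k. x k i) \<longlonglongrightarrow> y i"
  shows "majority_near_max 0 I y"
proof -
  have "\<forall>\<^sub>F k in sequentially. i \<notin> near_max (\<epsilon> k) I (x k)" if i: "i \<in> I - near_max 0 I y" for i
  proof -
    obtain j where j: "j \<in> I" "y i < y j" using i by (auto simp: near_max_def not_le)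
    have "(\<lambda>k. x k i + \<epsilon> k - x k j) \<longlonglongrightarrow> y i + 0 - y j"
      using i j by (intro tendsto_intros x \<epsilon>) auto
    then have "\<forall>\<^sub>F k in sequentially. x k i + \<epsilon> k - x k j < 0"
      using j by (intro order_tendstoD) auto
    then show ?thesis by eventually_elim (use j in \<open>auto simp: near_max_def not_le\<close>)
  qed
  then have "\<forall>\<^sub>F k in sequentially. \<forall>i\<in>I - near_max 0 I y. i \<notin> near_max (\<epsilon> k) I (x k)"
    using I by (intro eventually_ball_finite) auto
  then obtain k where "\<forall>i\<in>I - near_max 0 I y. i \<notin> near_max (\<epsilon> k) I (x k)"
    using eventually_happens by (metis (no_types, lifting) sequentially_bot)
  then have sub: "near_max (\<epsilon> k) I (x k) \<subseteq> near_max 0 I y"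
    using near_max_subset[of "\<epsilon> k" I "x k"] by blast
  have "finite (near_max 0 I y)" by (rule finite_subset[OF near_max_subset I])
  from card_mono[OF this sub] maj[of k] show ?thesis by (simp add: majority_near_max_def)
qed

lemma majority_near_max_affine:
  assumes "0 < N"
  shows "majority_near_max (C / N) I (\<lambda>i. (x i - b) / N) \<longleftrightarrow> majority_near_max C I x"
proof -
  have "((x j - b) / N \<le> (x i - b) / N + C / N) = (x j \<le> x i + C)" for i j
    using assms by (simp add: field_simps)
  then show ?thesis by (simp add: majority_near_max_def near_max_def)
qed

text \<open>
  In the limit one member \<open>H s\<close> dominates all others on \<open>ball 0 R\<close>, so Harnack's inequality bounds
  the derivatives at \<open>0\<close> of all differences by \<open>4 / R\<close>. For the given \<open>R\<close> their sum over all pairs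
  is less than \<open>1\<close>.
\<close>

lemma no_rescaled_majority_sequence:
  fixes G :: "nat \<Rightarrow> 'i \<Rightarrow> complex \<Rightarrow> complex"
  assumes I: "finite I" and R: "R > 4 * (real (card I))\<^sup>2" and \<epsilon>: "\<epsilon> \<longlonglongrightarrow> 0"
    and hol: "\<And>k i. i \<in> I \<Longrightarrow> G k i holomorphic_on ball 0 R"
    and bd: "\<And>k i z. i \<in> I \<Longrightarrow> z \<in> ball 0 R \<Longrightarrow> norm (G k i z) \<le> B"
    and maj: "\<And>k z. z \<in> ball 0 R \<Longrightarrow> majority_near_max (\<epsilon> k) I (\<lambda>i. Re (G k i z))"
    and one: "\<And>k. (\<Sum>(i,j)\<in>I \<times> I. norm (deriv (G k i) 0 - deriv (G k j) 0)) = 1"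
    and le1: "\<And>k. (\<Sum>(i,j)\<in>I \<times> I. \<bar>Re (G k i 0 - G k j 0)\<bar>) \<le> 1"
  shows False
proof -
  have R0: "R > 0" using R by (smt (verit) zero_le_power2)
  then have zero: "0 \<in> ball 0 R" by simp
  obtain r H where H: "\<And>i. i \<in> I \<Longrightarrow> H i holomorphic_on ball 0 R"
      "\<And>i z. i \<in> I \<Longrightarrow> z \<in> ball 0 R \<Longrightarrow> (\<lambda>k. G (r k) i z) \<longlonglongrightarrow> H i z"
      "\<And>i z. i \<in> I \<Longrightarrow> z \<in> ball 0 R \<Longrightarrow> (\<lambda>k. deriv (G (r k) i) z) \<longlonglongrightarrow> deriv (H i) z"
    and r: "strict_mono (r :: nat \<Rightarrow> nat)"
    using Montel_finite_family[of I "ball 0 R" G B, OF I open_ball hol bd] by blast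
  have "majority_near_max 0 I (\<lambda>i. Re (H i z))" if "z \<in> ball 0 R" for z
  proof (rule majority_near_max_limit[where \<epsilon> = "\<epsilon> \<circ> r" and x = "\<lambda>k i. Re (G (r k) i z)"])
    show "(\<epsilon> \<circ> r) \<longlonglongrightarrow> 0" by (rule LIMSEQ_subseq_LIMSEQ[OF \<epsilon> r])
  qed (use that I maj H(2) in \<open>auto intro: tendsto_Re\<close>)
  then obtain s where s: "s \<in> I" "\<And>j z. j \<in> I \<Longrightarrow> z \<in> ball 0 R \<Longrightarrow> Re (H j z) \<le> Re (H s z)"
    using majority_leader[of I "ball 0 R" H] I H(1) R0 by auto
  have le1': "(\<Sum>(i,j)\<in>I \<times> I. \<bar>Re (H i 0 - H j 0)\<bar>) \<le> 1"
  proof (rule tendsto_upperbound)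
    show "(\<lambda>k. \<Sum>(i,j)\<in>I \<times> I. \<bar>Re (G (r k) i 0 - G (r k) j 0)\<bar>) \<longlonglongrightarrow> (\<Sum>(i,j)\<in>I \<times> I. \<bar>Re (H i 0 - H j 0)\<bar>)"
      unfolding case_prod_beta using H(2) zero by (intro tendsto_intros) auto
  qed (use le1 in \<open>auto intro!: always_eventually\<close>)
  have one': "(\<Sum>(i,j)\<in>I \<times> I. norm (deriv (H i) 0 - deriv (H j) 0)) = 1"
  proof (rule LIMSEQ_unique)
    show "(\<lambda>k. \<Sum>(i,j)\<in>I \<times> I. norm (deriv (G (r k) i) 0 - deriv (G (r k) j) 0)) \<longlonglongrightarrow>
        (\<Sum>(i,j)\<in>I \<times> I. norm (deriv (H i) 0 - deriv (H j) 0))"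
      unfolding case_prod_beta using H(3) zero by (intro tendsto_intros) auto
    show "(\<lambda>k. \<Sum>(i,j)\<in>I \<times> I. norm (deriv (G (r k) i) 0 - deriv (G (r k) j) 0)) \<longlonglongrightarrow> 1"
      by (simp add: one)
  qed
  have d: "norm (deriv (H s) 0 - deriv (H j) 0) \<le> 2 / R" if j: "j \<in> I" for j
  proof -
    have "norm (deriv (\<lambda>z. H s z - H j z) 0) * R \<le> 2 * Re (H s 0 - H j 0)"
      using s(2)[OF j] H(1) s(1) j R0 by (intro deriv_bound_of_Re_nonneg holomorphic_intros) auto
    also have "deriv (\<lambda>z. H s z - H j z) 0 = deriv (H s) 0 - deriv (H j) 0"
      using H(1) s(1) j zero by (intro deriv_diff holomorphic_on_imp_differentiable_at[OF _ open_ball]) auto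
    also have "Re (H s 0 - H j 0) \<le> (\<Sum>(i,j)\<in>I \<times> I. \<bar>Re (H i 0 - H j 0)\<bar>)"
      using member_le_sum[of "(s, j)" "I \<times> I" "\<lambda>(i,j). \<bar>Re (H i 0 - H j 0)\<bar>"] I s(1) j by auto
    finally show ?thesis using le1' R0 by (simp add: field_simps)
  qed
  have "(\<Sum>(i,j)\<in>I \<times> I. norm (deriv (H i) 0 - deriv (H j) 0)) \<le> (\<Sum>(i,j)\<in>I \<times> I. 4 / R)"
  proof (rule sum_mono, clarify)
    fix i j assume "i \<in> I" "j \<in> I"
    then show "norm (deriv (H i) 0 - deriv (H j) 0) \<le> 4 / R"
      using d[of i] d[of j] norm_triangle_ineq4[of "deriv (H s) 0 - deriv (H j) 0" "deriv (H s) 0 - deriv (H i) 0"]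
      by simp
  qed
  also have "\<dots> = 4 * (real (card I))\<^sup>2 / R"
    by (simp add: card_cartesian_product power2_eq_square)
  also have "\<dots> < 1" using R R0 by simp
  finally show False using one' by simp
qed

text \<open>
  The rescaled family at a centre given by \<open>rescaling_point\<close>. Subtracting \<open>g b\<close> and an imaginary
  constant does not affect differences of real parts and makes the family bounded. The
  constant \<open>A\<close> in the denominator \<open>h\<close> ensures \<open>A \<le> N\<close>, hence that the tolerance \<open>C / N\<close> is small
  when \<open>A\<close> is large, whatever the size of the real parts at the centre is.
\<close>

lemma landau_rescaling:
  fixes g :: "'i \<Rightarrow> complex \<Rightarrow> complex"
  assumes I: "finite I" "b \<in> I" and A: "0 < A" and R: "0 < R"
    and hol: "\<And>i. i \<in> I \<Longrightarrow> g i holomorphic_on ball 0 1"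
    and maj: "\<And>z. z \<in> ball 0 1 \<Longrightarrow> majority_near_max C I (\<lambda>i. Re (g i z))"
    and w: "w \<in> cball 0 (1/4)"
    and big: "(\<Sum>(i,j)\<in>I \<times> I. norm (deriv (g i) w - deriv (g j) w)) >
                8 * R * (A + (\<Sum>(i,j)\<in>I \<times> I. \<bar>Re (g i w - g j w)\<bar>))"
  obtains G N where "A \<le> N" "\<And>i. i \<in> I \<Longrightarrow> G i holomorphic_on ball 0 R"
    "\<And>i z. i \<in> I \<Longrightarrow> z \<in> ball 0 R \<Longrightarrow> norm (G i z) \<le> 1 + 4 * exp (4 * (real (card I))\<^sup>2 * R) * R"
    "\<And>z. z \<in> ball 0 R \<Longrightarrow> majority_near_max (C / N) I (\<lambda>i. Re (G i z))"
    "(\<Sum>(i,j)\<in>I \<times> I. norm (deriv (G i) 0 - deriv (G j) 0)) = 1"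
    "(\<Sum>(i,j)\<in>I \<times> I. \<bar>Re (G i 0 - G j 0)\<bar>) \<le> 1"
proof -
  define s where "s x = (\<Sum>(i,j)\<in>I \<times> I. norm (deriv (g i) x - deriv (g j) x))" for x
  define h where "h x = A + (\<Sum>(i,j)\<in>I \<times> I. \<bar>Re (g i x - g j x)\<bar>)" for x
  have sub: "cball (0::complex) (1/2) \<subseteq> ball 0 1" by auto
  have cg: "continuous_on (cball 0 (1/2)) (g i)" "continuous_on (cball 0 (1/2)) (deriv (g i))"
    if "i \<in> I" for i
    using hol[OF that] holomorphic_deriv[OF hol[OF that] open_ball]
    by (auto intro!: continuous_on_subset[OF _ sub] holomorphic_on_imp_continuous_on)
  have cs: "continuous_on (cball 0 (1/2)) s" "continuous_on (cball 0 (1/2)) h"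
    unfolding s_def h_def case_prod_beta using cg by (auto intro!: continuous_intros)
  have hA: "A \<le> h x" for x unfolding h_def by (auto intro!: sum_nonneg)
  have s0: "0 \<le> s x" for x unfolding s_def by (auto intro!: sum_nonneg)
  obtain z \<rho> where \<rho>: "0 < \<rho>" and zb: "cball z (\<rho> * R) \<subseteq> ball 0 (1/2)" and sz: "\<rho> * s z = h z"
    and dbl: "\<And>x. x \<in> cball z (\<rho> * R) \<Longrightarrow> \<rho> * s x \<le> 2 * h x"
  proof (rule rescaling_point[OF cs, of R w])
    show "0 < h x" for x using hA[of x] A by simp
    show "4 * R * h w < 1/2 * s w" using big by (simp add: s_def h_def)
  qed (use s0 R w in auto)
  define N where "N = h z"
  have N: "0 < N" "A \<le> N" using hA[of z] A by (simp_all add: N_def)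
  have in1: "z + of_real \<rho> * x \<in> cball z (\<rho> * R)" "z + of_real \<rho> * x \<in> ball 0 1" if "x \<in> ball 0 R" for x
  proof -
    show 1: "z + of_real \<rho> * x \<in> cball z (\<rho> * R)"
      using that \<rho> by (simp add: dist_norm norm_mult)
    show "z + of_real \<rho> * x \<in> ball 0 1" using subsetD[OF zb 1] by simp
  qed
  define G where "G i x = (g i (z + of_real \<rho> * x) - g b (z + of_real \<rho> * x) -
                            \<i> * of_real (Im (g i z - g b z))) / of_real N" for i x
  have comp: "(\<lambda>x. g i (z + of_real \<rho> * x)) holomorphic_on ball 0 R" if "i \<in> I" for i
    using in1 by (intro holomorphic_on_compose_gen[OF _ hol[OF that], unfolded o_def] holomorphic_intros) auto
  have holG: "G i holomorphic_on ball 0 R" if "i \<in> I" for i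
    unfolding G_def using comp that I N by (intro holomorphic_intros) auto
  have ReG: "Re (G i x) = (Re (g i (z + of_real \<rho> * x)) - Re (g b (z + of_real \<rho> * x))) / N" for i x
    by (simp add: G_def)
  have ReGG: "Re (G i x - G j x) = Re (g i (z + of_real \<rho> * x) - g j (z + of_real \<rho> * x)) / N" for i j x
    by (simp add: ReG diff_divide_distrib)
  have dG: "deriv (G i) x = of_real (\<rho> / N) * (deriv (g i) (z + of_real \<rho> * x) - deriv (g b) (z + of_real \<rho> * x))"
    if x: "x \<in> ball 0 R" and i: "i \<in> I" for i x
  proof -
    have D: "((\<lambda>x. g i (z + of_real \<rho> * x)) has_field_derivative deriv (g i) (z + of_real \<rho> * x) * of_real \<rho>) (at x)"
      if "i \<in> I" for i
    proof -
      have "(g i has_field_derivative deriv (g i) (z + of_real \<rho> * x)) (at (z + of_real \<rho> * x))"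
        by (rule holomorphic_derivI[OF hol[OF that] open_ball in1(2)[OF x]])
      then show ?thesis by (rule DERIV_chain2) (auto intro!: derivative_eq_intros)
    qed
    have "(G i has_field_derivative (deriv (g i) (z + of_real \<rho> * x) * of_real \<rho> -
        deriv (g b) (z + of_real \<rho> * x) * of_real \<rho> - 0) / of_real N) (at x)"
      unfolding G_def by (intro DERIV_cdivide DERIV_diff D i I DERIV_const)
    from DERIV_imp_deriv[OF this] show ?thesis by (simp add: field_simps)
  qed
  have dGG: "norm (deriv (G i) x - deriv (G j) x) =
      \<rho> / N * norm (deriv (g i) (z + of_real \<rho> * x) - deriv (g j) (z + of_real \<rho> * x))"
    if "x \<in> ball 0 R" "i \<in> I" "j \<in> I" for i j x
    unfolding dG[OF that(1,2)] dG[OF that(1,3)] right_diff_distrib[symmetric] norm_mult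
    using \<rho> N by (simp add: norm_divide)
  have sumd: "(\<Sum>(i,j)\<in>I \<times> I. norm (deriv (G i) x - deriv (G j) x)) = \<rho> / N * s (z + of_real \<rho> * x)"
    if "x \<in> ball 0 R" for x
    unfolding s_def sum_distrib_left using dGG[OF that] by (intro sum.cong) auto
  have sumR: "A / N + (\<Sum>(i,j)\<in>I \<times> I. \<bar>Re (G i x - G j x)\<bar>) = h (z + of_real \<rho> * x) / N" for x
    unfolding h_def add_divide_distrib sum_divide_distrib ReGG using N by (simp add: case_prod_beta)
  have zero: "0 \<in> ball (0::complex) R" using R by simp
  have one: "(\<Sum>(i,j)\<in>I \<times> I. norm (deriv (G i) 0 - deriv (G j) 0)) = 1"
    using sumd[OF zero] sz N by (simp add: N_def)
  have hz1: "A / N + (\<Sum>(i,j)\<in>I \<times> I. \<bar>Re (G i 0 - G j 0)\<bar>) = 1"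
    using sumR[of 0] N by (simp add: N_def)
  have AN: "0 < A / N" using A N by simp
  define E where "E = exp (4 * (real (card I))\<^sup>2 * R)"
  have ddiff: "deriv (\<lambda>y. G i y - G j y) x = deriv (G i) x - deriv (G j) x"
    if "x \<in> ball 0 R" "i \<in> I" "j \<in> I" for i j x
    using holG that by (intro deriv_diff holomorphic_on_imp_differentiable_at[OF _ open_ball]) auto
  have pd: "norm (deriv (G i) x - deriv (G j) x) \<le> 2 * (A / N + (\<Sum>(i,j)\<in>I \<times> I. \<bar>Re (G i x - G j x)\<bar>))"
    if x: "x \<in> ball 0 R" and ij: "i \<in> I" "j \<in> I" for i j x
  proof -
    have "norm (deriv (G i) x - deriv (G j) x) \<le> (\<Sum>(i,j)\<in>I \<times> I. norm (deriv (G i) x - deriv (G j) x))"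
      using member_le_sum[of "(i, j)" "I \<times> I" "\<lambda>(i,j). norm (deriv (G i) x - deriv (G j) x)"] I ij by auto
    also have "\<dots> = \<rho> * s (z + of_real \<rho> * x) / N" using sumd[OF x] by simp
    also have "\<dots> \<le> 2 * h (z + of_real \<rho> * x) / N"
      using dbl[OF in1(1)[OF x]] N by (intro divide_right_mono) auto
    finally show ?thesis unfolding sumR by simp
  qed
  have growth: "A / N + (\<Sum>(i,j)\<in>I \<times> I. \<bar>Re (G i x - G j x)\<bar>) \<le> 2 * E" if x: "x \<in> ball 0 R" for x
  proof -
    have "A / N + (\<Sum>p\<in>I \<times> I. \<bar>Re (G (fst p) x - G (snd p) x)\<bar>) \<le>
        2 * exp (2 * card (I \<times> I) * (2::real) * R) * (A / N + (\<Sum>p\<in>I \<times> I. \<bar>Re (G (fst p) 0 - G (snd p) 0)\<bar>))"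
    proof (rule gronwall_holomorphic_family[where f = "\<lambda>p x. G (fst p) x - G (snd p) x"])
      show "(\<lambda>x. G (fst p) x - G (snd p) x) holomorphic_on ball 0 R" if "p \<in> I \<times> I" for p
        using that holG by (intro holomorphic_intros) auto
      show "norm (deriv (\<lambda>x. G (fst p) x - G (snd p) x) y) \<le>
          2 * (A / N + (\<Sum>q\<in>I \<times> I. \<bar>Re (G (fst q) y - G (snd q) y)\<bar>))"
        if "p \<in> I \<times> I" "y \<in> ball 0 R" for p y
        using pd[of y "fst p" "snd p"] ddiff[of y "fst p" "snd p"] that by (auto simp: case_prod_beta)
    qed (use I R x AN in auto)
    then show ?thesis using hz1
      by (simp add: case_prod_beta E_def card_cartesian_product power2_eq_square mult_ac)
  qed
  have Gb: "G b x = 0" for x by (simp add: G_def)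
  have bound: "norm (G i x) \<le> 1 + 4 * E * R" if x: "x \<in> ball 0 R" and i: "i \<in> I" for i x
  proof -
    have "norm (G i x - G i 0) \<le> 4 * E * norm (x - 0)"
    proof (rule field_differentiable_bound[of "ball 0 R"])
      fix y assume y: "y \<in> ball (0::complex) R"
      show "(G i has_field_derivative deriv (G i) y) (at y within ball 0 R)"
        using holomorphic_derivI[OF holG[OF i] open_ball y] has_field_derivative_at_within by blast
      have "deriv (G b) y = 0" using Gb by (simp add: ext[of "G b" "\<lambda>_. 0"])
      then show "norm (deriv (G i) y) \<le> 4 * E"
        using pd[OF y i I(2)] growth[OF y] by simp
    qed (use x R in auto)
    also have "\<dots> \<le> 4 * E * R" using x by (intro mult_left_mono) (auto simp: E_def)
    finally have 1: "norm (G i x - G i 0) \<le> 4 * E * R" .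
    have "Im (G i 0) = 0" by (simp add: G_def)
    then have "norm (G i 0) = \<bar>Re (G i 0 - G b 0)\<bar>" by (simp add: Gb cmod_eq_Re)
    also have "\<dots> \<le> (\<Sum>(i,j)\<in>I \<times> I. \<bar>Re (G i 0 - G j 0)\<bar>)"
      using member_le_sum[of "(i, b)" "I \<times> I" "\<lambda>(i,j). \<bar>Re (G i 0 - G j 0)\<bar>"] I i by auto
    also have "\<dots> \<le> 1" using hz1 AN by simp
    finally show ?thesis using 1 norm_triangle_ineq[of "G i x - G i 0" "G i 0"] by simp
  qed
  have major: "majority_near_max (C / N) I (\<lambda>i. Re (G i x))" if "x \<in> ball 0 R" for x
    unfolding ReG majority_near_max_affine[OF N(1)] by (rule maj[OF in1(2)[OF that]])
  show ?thesis
    by (rule that[of N G]) (use N holG bound major one hz1 AN in \<open>auto simp: E_def\<close>)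
qed

text \<open>
  If no \<open>A\<close> worked for \<open>K = 8R\<close>, the rescaled families for \<open>A = 1, 2, 3, \<dots>\<close> would form a sequence
  that is excluded by \<open>no_rescaled_majority_sequence\<close>.
\<close>

lemma landau_majority:
  fixes I :: "'i set"
  assumes I: "finite I" "I \<noteq> {}"
  shows "\<exists>A>0. \<exists>K>0. \<forall>g. (\<forall>i\<in>I. g i holomorphic_on ball 0 1) \<and>
           (\<forall>z\<in>ball 0 1. majority_near_max C I (\<lambda>i. Re (g i z))) \<longrightarrow>
           (\<forall>w\<in>cball 0 (1/4). (\<Sum>(i,j)\<in>I \<times> I. norm (deriv (g i) w - deriv (g j) w)) \<le>
                K * (A + (\<Sum>(i,j)\<in>I \<times> I. \<bar>Re (g i w - g j w)\<bar>)))"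
proof (rule ccontr)
  assume contra: "\<not> ?thesis"
  obtain b where b: "b \<in> I" using I by blast
  define R where "R = 4 * (real (card I))\<^sup>2 + 1"
  have R: "R > 0" by (simp add: R_def add_nonneg_pos)
  define L where "L = 1 + 4 * exp (4 * (real (card I))\<^sup>2 * R) * R"
  have "\<exists>G N. real k + 1 \<le> N \<and> (\<forall>i\<in>I. G i holomorphic_on ball 0 R) \<and>
      (\<forall>i\<in>I. \<forall>z\<in>ball 0 R. norm (G i z) \<le> L) \<and>
      (\<forall>z\<in>ball 0 R. majority_near_max (C / N) I (\<lambda>i. Re (G i z))) \<and>
      (\<Sum>(i,j)\<in>I \<times> I. norm (deriv (G i) 0 - deriv (G j) 0)) = 1 \<and>
      (\<Sum>(i,j)\<in>I \<times> I. \<bar>Re (G i 0 - G j 0)\<bar>) \<le> 1" for k :: nat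
  proof -
    have A: "0 < real k + 1" by simp
    have "8 * R > 0" using R by simp
    with contra A obtain g w where g: "\<And>i. i \<in> I \<Longrightarrow> g i holomorphic_on ball 0 1"
        "\<And>z. z \<in> ball 0 1 \<Longrightarrow> majority_near_max C I (\<lambda>i. Re (g i z))"
        "w \<in> cball 0 (1/4)" "(\<Sum>(i,j)\<in>I \<times> I. norm (deriv (g i) w - deriv (g j) w)) >
                8 * R * (real k + 1 + (\<Sum>(i,j)\<in>I \<times> I. \<bar>Re (g i w - g j w)\<bar>))"
      by (metis not_le)
    show ?thesis
    proof (rule landau_rescaling[OF I(1) b A R g])
      fix G N
      assume "real k + 1 \<le> N" "\<And>i. i \<in> I \<Longrightarrow> G i holomorphic_on ball 0 R"
        "\<And>i z. i \<in> I \<Longrightarrow> z \<in> ball 0 R \<Longrightarrow> norm (G i z) \<le> 1 + 4 * exp (4 * (real (card I))\<^sup>2 * R) * R"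
        "\<And>z. z \<in> ball 0 R \<Longrightarrow> majority_near_max (C / N) I (\<lambda>i. Re (G i z))"
        "(\<Sum>(i,j)\<in>I \<times> I. norm (deriv (G i) 0 - deriv (G j) 0)) = 1"
        "(\<Sum>(i,j)\<in>I \<times> I. \<bar>Re (G i 0 - G j 0)\<bar>) \<le> 1"
      then show ?thesis unfolding L_def by (intro exI[of _ G] exI[of _ N] conjI ballI)
    qed
  qed
  then obtain G N where N: "\<And>k::nat. real k + 1 \<le> N k"
    and G: "\<And>k i. i \<in> I \<Longrightarrow> G k i holomorphic_on ball 0 R"
      "\<And>k i z. i \<in> I \<Longrightarrow> z \<in> ball 0 R \<Longrightarrow> norm (G k i z) \<le> L"
      "\<And>k z. z \<in> ball 0 R \<Longrightarrow> majority_near_max (C / N k) I (\<lambda>i. Re (G k i z))"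
      "\<And>k. (\<Sum>(i,j)\<in>I \<times> I. norm (deriv (G k i) 0 - deriv (G k j) 0)) = 1"
      "\<And>k. (\<Sum>(i,j)\<in>I \<times> I. \<bar>Re (G k i 0 - G k j 0)\<bar>) \<le> 1"
    by metis
  have "filterlim N at_top sequentially"
  proof (rule filterlim_at_top_mono[OF filterlim_real_sequentially always_eventually], rule allI)
    show "real k \<le> N k" for k using N[of k] by simp
  qed
  then have lim: "(\<lambda>k. C / N k) \<longlonglongrightarrow> 0"
    by (intro tendsto_divide_0[OF tendsto_const] filterlim_at_top_imp_at_infinity)
  show False
    by (rule no_rescaled_majority_sequence[OF I(1) _ lim G]) (simp_all add: R_def)
qed

text \<open>
  The Landau estimate bounds the derivatives by the real parts on the disc of radius \<open>1/4\<close>, where it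
  can therefore be integrated.
\<close>

theorem schottky_majority:
  fixes I :: "'i set"
  assumes I: "finite I" "I \<noteq> {}"
  shows "\<exists>M. \<forall>g. (\<forall>i\<in>I. g i holomorphic_on ball 0 1) \<and>
           (\<forall>z\<in>ball 0 1. majority_near_max C I (\<lambda>i. Re (g i z))) \<and>
           (\<forall>i\<in>I. \<forall>j\<in>I. \<bar>Re (g i 0 - g j 0)\<bar> \<le> B) \<longrightarrow>
           (\<forall>z\<in>ball 0 (1/4). \<forall>i\<in>I. \<forall>j\<in>I. \<bar>Re (g i z - g j z)\<bar> \<le> M)"
proof -
  obtain A K where A: "A > 0" and K: "K > 0"
    and landau: "\<forall>g. (\<forall>i\<in>I. g i holomorphic_on ball 0 1) \<and>
           (\<forall>z\<in>ball 0 1. majority_near_max C I (\<lambda>i. Re (g i z))) \<longrightarrow>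
           (\<forall>w\<in>cball 0 (1/4). (\<Sum>(i,j)\<in>I \<times> I. norm (deriv (g i) w - deriv (g j) w)) \<le>
                K * (A + (\<Sum>(i,j)\<in>I \<times> I. \<bar>Re (g i w - g j w)\<bar>)))"
    using landau_majority[OF I, of C] by (elim exE conjE) (rule that)
  define M where "M = 2 * exp (2 * card (I \<times> I) * K * (1/4)) * (A + (\<Sum>p\<in>I \<times> I. B))"
  show ?thesis
  proof (intro exI[of _ M] allI impI ballI, elim conjE)
    fix g z i j
    assume hol: "\<forall>i\<in>I. g i holomorphic_on ball 0 1"
      and maj: "\<forall>z\<in>ball 0 1. majority_near_max C I (\<lambda>i. Re (g i z))"
      and B: "\<forall>i\<in>I. \<forall>j\<in>I. \<bar>Re (g i 0 - g j 0)\<bar> \<le> B"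
      and z: "z \<in> ball (0::complex) (1/4)" and ij: "i \<in> I" "j \<in> I"
    have sub: "ball (0::complex) (1/4) \<subseteq> ball 0 1" by auto
    have "A + (\<Sum>p\<in>I \<times> I. \<bar>Re (g (fst p) z - g (snd p) z)\<bar>) \<le>
        2 * exp (2 * card (I \<times> I) * K * (1/4)) * (A + (\<Sum>p\<in>I \<times> I. \<bar>Re (g (fst p) 0 - g (snd p) 0)\<bar>))"
    proof (rule gronwall_holomorphic_family[where f = "\<lambda>p x. g (fst p) x - g (snd p) x"])
      show "(\<lambda>x. g (fst p) x - g (snd p) x) holomorphic_on ball 0 (1/4)" if "p \<in> I \<times> I" for p
        using that hol holomorphic_on_subset[OF _ sub] by (intro holomorphic_intros) auto
      show "norm (deriv (\<lambda>x. g (fst p) x - g (snd p) x) y) \<le>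
          K * (A + (\<Sum>q\<in>I \<times> I. \<bar>Re (g (fst q) y - g (snd q) y)\<bar>))"
        if p: "p \<in> I \<times> I" and y: "y \<in> ball 0 (1/4)" for p y
      proof -
        have "deriv (\<lambda>x. g (fst p) x - g (snd p) x) y = deriv (g (fst p)) y - deriv (g (snd p)) y"
          using hol p y by (intro deriv_diff holomorphic_on_imp_differentiable_at[OF _ open_ball[of 0 1]]) auto
        also have "norm \<dots> \<le> (\<Sum>(i,j)\<in>I \<times> I. norm (deriv (g i) y - deriv (g j) y))"
          using member_le_sum[of p "I \<times> I" "\<lambda>(i,j). norm (deriv (g i) y - deriv (g j) y)"] I p
          by (auto simp: case_prod_beta)
        also have "\<dots> \<le> K * (A + (\<Sum>(i,j)\<in>I \<times> I. \<bar>Re (g i y - g j y)\<bar>))"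
          by (rule landau[rule_format]) (use hol maj y in auto)
        finally show ?thesis by (simp add: case_prod_beta)
      qed
    qed (use I A K z in auto)
    also have "\<dots> \<le> M"
      unfolding M_def using B by (intro mult_left_mono add_left_mono sum_mono) auto
    finally have "A + (\<Sum>p\<in>I \<times> I. \<bar>Re (g (fst p) z - g (snd p) z)\<bar>) \<le> M" .
    moreover have "\<bar>Re (g i z - g j z)\<bar> \<le> (\<Sum>p\<in>I \<times> I. \<bar>Re (g (fst p) z - g (snd p) z)\<bar>)"
      using member_le_sum[of "(i, j)" "I \<times> I" "\<lambda>p. \<bar>Re (g (fst p) z - g (snd p) z)\<bar>"] I ij by auto
    ultimately show "\<bar>Re (g i z - g j z)\<bar> \<le> M" using A by simp
  qed
qed

section \<open>Values of monic polynomials outside their roots\<close>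

text \<open>
  Both sides are the top coefficient of the Lagrange interpolation polynomial of \<open>p\<close> at the
  points of \<open>J\<close>.
\<close>

lemma divided_difference_eq_coeff:
  fixes p :: "'a::field poly"
  assumes J: "finite J" and deg: "degree p < card J"
  shows "(\<Sum>a\<in>J. poly p a / (\<Prod>b\<in>J - {a}. a - b)) = coeff p (card J - 1)"
proof -
  define L where "L a = (\<Prod>b\<in>J - {a}. [:- b, 1:])" for a :: 'a
  define c where "c a = poly p a / (\<Prod>b\<in>J - {a}. a - b)" for a
  define q where "q = (\<Sum>a\<in>J. smult (c a) (L a))"
  have degL: "degree (L a) = card J - 1" if "a \<in> J" for a
    unfolding L_def using J that by (subst degree_prod_eq_sum_degree) auto
  have leadL: "coeff (L a) (card J - 1) = 1" if "a \<in> J" for a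
    unfolding degL[OF that, symmetric] by (simp add: L_def lead_coeff_prod)
  have "degree q \<le> card J - 1"
    unfolding q_def using degL by (intro degree_sum_le J order_trans[OF degree_smult_le]) auto
  moreover have "poly q x = poly p x" if x: "x \<in> J" for x
  proof -
    have "poly q x = (\<Sum>a\<in>J. if a = x then poly p x else 0)"
      unfolding q_def poly_sum
    proof (rule sum.cong)
      fix a assume a: "a \<in> J"
      have "poly (L a) x = 0" if "a \<noteq> x" unfolding L_def poly_prod using x that J by auto
      moreover have "(\<Prod>b\<in>J - {x}. x - b) \<noteq> 0" using J by auto
      ultimately show "poly (smult (c a) (L a)) x = (if a = x then poly p x else 0)"
        by (auto simp: c_def L_def poly_prod)
    qed simp
    then show ?thesis using x J by simp
  qed
  ultimately have "q = p" using deg J by (intro poly_eqI_degree[of J]) auto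
  moreover have "coeff q (card J - 1) = (\<Sum>a\<in>J. c a)"
    unfolding q_def coeff_sum using leadL by simp
  ultimately show ?thesis by (simp add: c_def)
qed

lemma finite_argmax:
  fixes f :: "'i \<Rightarrow> real"
  assumes "finite I" "I \<noteq> {}"
  obtains m where "m \<in> I" "\<And>i. i \<in> I \<Longrightarrow> f i \<le> f m"
proof -
  have "Max (f ` I) \<in> f ` I" using assms by (intro Max_in) auto
  then obtain m where "m \<in> I" "f m = Max (f ` I)" by (metis imageE)
  then show ?thesis using that[of m] assms(1) by simp
qed

text \<open>
  If at most \<open>n\<close> indices were near-maximal, some \<open>n + 1\<close> indices would be far below the
  maximal index \<open>m\<close>. In the relation between these \<open>n + 2\<close> indices, the term of \<open>m\<close> would
  then be larger than the sum of all others.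
\<close>

lemma majority_of_relations:
  fixes V :: "('i \<Rightarrow> complex) set"
  assumes I: "finite I" "card I = 2 * n + 1"
    and rel: "\<And>J. J \<subseteq> I \<Longrightarrow> card J = n + 2 \<Longrightarrow>
                \<exists>c. (\<forall>j\<in>J. c j \<noteq> 0) \<and> (\<forall>v\<in>V. (\<Sum>j\<in>J. c j * v j) = 0)"
  shows "\<exists>C. \<forall>v\<in>V. (\<forall>i\<in>I. v i \<noteq> 0) \<longrightarrow> majority_near_max C I (\<lambda>i. ln (norm (v i)))"
proof -
  define c where "c J = (SOME c. (\<forall>j\<in>J. c j \<noteq> 0) \<and> (\<forall>v\<in>V. (\<Sum>j\<in>J. c j * v j) = 0))" for J
  have c: "(\<forall>j\<in>J. c J j \<noteq> 0) \<and> (\<forall>v\<in>V. (\<Sum>j\<in>J. c J j * v j) = 0)"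
    if "J \<subseteq> I" "card J = n + 2" for J
    unfolding c_def by (rule someI_ex[OF rel[OF that]])
  have c0: "c J j \<noteq> 0" if "J \<subseteq> I" "card J = n + 2" "j \<in> J" for J j
    using c[OF that(1,2)] that(3) by blast
  have crel: "(\<Sum>j\<in>J. c J j * v j) = 0" if "J \<subseteq> I" "card J = n + 2" "v \<in> V" for J v
    using c[OF that(1,2)] that(3) by blast
  \<comment> \<open>\<open>exp C\<close> has to exceed the finitely many quotients \<open>K J i\<close>. The sum of the absolute values of
    their logarithms is such a \<open>C\<close>, and it is nonnegative.\<close>
  define K where "K J i = (\<Sum>j\<in>J - {i}. norm (c J j)) / norm (c J i)" for J i
  define C where "C = (\<Sum>J\<in>Pow I. \<Sum>i\<in>I. \<bar>ln (K J i)\<bar>)"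
  have C0: "C \<ge> 0" unfolding C_def by (intro sum_nonneg) auto
  have KC: "K J i \<le> exp C" if J: "J \<subseteq> I" and i: "i \<in> I" for J i
  proof (cases "K J i > 0")
    case True
    have "ln (K J i) \<le> \<bar>ln (K J i)\<bar>" by simp
    also have "\<dots> \<le> (\<Sum>i\<in>I. \<bar>ln (K J i)\<bar>)" using I i by (intro member_le_sum) auto
    also have "\<dots> \<le> C" unfolding C_def using I J by (intro member_le_sum sum_nonneg) auto
    finally have "exp (ln (K J i)) \<le> exp C" by simp
    then show ?thesis using True by simp
  next
    case False
    then show ?thesis using exp_gt_zero[of C] by linarith
  qed
  show ?thesis
  proof (intro exI[of _ C] ballI impI, rule ccontr)
    fix v assume v: "v \<in> V" and v0: "\<forall>i\<in>I. v i \<noteq> 0"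
    define T where "T = near_max C I (\<lambda>i. ln (norm (v i)))"
    assume "\<not> majority_near_max C I (\<lambda>i. ln (norm (v i)))"
    then have cT: "card T \<le> n" using I by (simp add: majority_near_max_def T_def)
    have TI: "T \<subseteq> I" unfolding T_def by (rule near_max_subset)
    have ne: "I \<noteq> {}" using I by auto
    obtain m where m: "m \<in> I" "\<And>i. i \<in> I \<Longrightarrow> norm (v i) \<le> norm (v m)"
      by (rule finite_argmax[OF I(1) ne, of "\<lambda>i. norm (v i)"]) blast
    have mT: "m \<in> T" unfolding T_def near_max_def
    proof (intro CollectI conjI m(1) ballI)
      fix j assume "j \<in> I"
      then have "ln (norm (v j)) \<le> ln (norm (v m))" using m v0 by simp
      then show "ln (norm (v j)) \<le> ln (norm (v m)) + C" using C0 by simp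
    qed
    have "n + 1 \<le> card (I - T)" using cT I TI by (simp add: card_Diff_subset finite_subset)
    then obtain J' where J': "J' \<subseteq> I - T" "card J' = n + 1" "finite J'"
      by (meson obtain_subset_with_card_n)
    define J where "J = insert m J'"
    have mJ': "m \<notin> J'" using J' mT by auto
    have J: "J \<subseteq> I" "card J = n + 2" "J - {m} = J'" using J' m mJ' by (auto simp: J_def)
    have small: "norm (v j) < exp (- C) * norm (v m)" if "j \<in> J'" for j
    proof -
      have j: "j \<in> I" "j \<notin> T" using that J' by auto
      then obtain l where l: "l \<in> I" "ln (norm (v j)) + C < ln (norm (v l))"
        by (auto simp: T_def near_max_def not_le)
      have "ln (norm (v j)) < - C + ln (norm (v m))" using l m(2)[OF l(1)] v0 m(1) by (smt (verit) ln_le_cancel_iff zero_less_norm_iff)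
      then have "exp (ln (norm (v j))) < exp (- C) * exp (ln (norm (v m)))"
        unfolding exp_add[symmetric] exp_less_cancel_iff .
      then show ?thesis using v0 j(1) m(1) by simp
    qed
    have cm: "c J m \<noteq> 0" using c0[OF J(1,2), of m] by (simp add: J_def)
    have "(\<Sum>j\<in>J. c J j * v j) = c J m * v m + (\<Sum>j\<in>J'. c J j * v j)"
      using J' mJ' by (simp add: J_def)
    then have "c J m * v m = - (\<Sum>j\<in>J'. c J j * v j)"
      using crel[OF J(1,2) v] by (simp add: eq_neg_iff_add_eq_0)
    then have "norm (c J m) * norm (v m) = norm (\<Sum>j\<in>J'. c J j * v j)"
      by (metis norm_minus_cancel norm_mult)
    also have "\<dots> \<le> (\<Sum>j\<in>J'. norm (c J j) * norm (v j))" by (simp add: sum_norm_le norm_mult)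
    also have "\<dots> < (\<Sum>j\<in>J'. norm (c J j) * (exp (- C) * norm (v m)))"
    proof (rule sum_strict_mono)
      show "J' \<noteq> {}" using J' by auto
      fix j assume j: "j \<in> J'"
      then have "c J j \<noteq> 0" using c0[OF J(1,2), of j] by (simp add: J_def)
      then show "norm (c J j) * norm (v j) < norm (c J j) * (exp (- C) * norm (v m))"
        using small[OF j] by (intro mult_strict_left_mono) auto
    qed (rule J')
    also have "\<dots> = (K J m * norm (c J m)) * (exp (- C) * norm (v m))"
    proof -
      have "K J m * norm (c J m) = (\<Sum>j\<in>J'. norm (c J j))" using cm by (simp add: K_def J(3))
      then show ?thesis by (simp only: sum_distrib_right)
    qed
    also have "\<dots> \<le> (exp C * norm (c J m)) * (exp (- C) * norm (v m))"
      using KC[OF J(1) m(1)] by (intro mult_right_mono) auto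
    also have "\<dots> = norm (c J m) * norm (v m)" by (simp add: exp_minus field_simps)
    finally show False by simp
  qed
qed

text \<open>
  The index \<open>None\<close> stands for the hyperplane at infinity of the affine space of monic polynomials.
\<close>

definition monic_values :: "complex poly \<Rightarrow> complex option \<Rightarrow> complex" where
  "monic_values p i = (case i of None \<Rightarrow> 1 | Some a \<Rightarrow> poly p a)"

text \<open>
  The relation between \<open>n + 2\<close> of the values is a divided difference. Over \<open>n + 2\<close> points it is \<open>0\<close>
  because \<open>p\<close> has degree \<open>n\<close>; over \<open>n + 1\<close> points it is the leading coefficient \<open>1\<close>, which is the
  value with index \<open>None\<close>.
\<close>

lemma majority_of_monic_values:
  assumes T: "finite T" "card T = 2 * n"
  shows "\<exists>C. \<forall>p. degree p = n \<and> lead_coeff p = 1 \<and> (\<forall>a\<in>T. poly p a \<noteq> 0) \<longrightarrow>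
           majority_near_max C (insert None (Some ` T)) (\<lambda>i. ln (norm (monic_values p i)))"
proof -
  define V where "V = monic_values ` {p. degree p = n \<and> lead_coeff p = 1}"
  let ?I = "insert None (Some ` T)"
  have "\<exists>C. \<forall>v\<in>V. (\<forall>i\<in>?I. v i \<noteq> 0) \<longrightarrow> majority_near_max C ?I (\<lambda>i. ln (norm (v i)))"
  proof (rule majority_of_relations)
    show "finite ?I" "card ?I = 2 * n + 1" using T by (auto simp: card_image)
    fix J assume J: "J \<subseteq> ?I" "card J = n + 2"
    define L where "L = {a. Some a \<in> J}"
    have finJ: "finite J" using J by (metis T(1) finite_imageI finite_insert finite_subset)
    have finL: "finite L" unfolding L_def
      by (rule finite_subset[OF _ T(1)]) (use J in auto)
    define d where "d a = 1 / (\<Prod>b\<in>L - {a}. a - b)" for a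
    have d0: "d a \<noteq> 0" for a unfolding d_def using finL by auto
    have dd: "(\<Sum>a\<in>L. d a * poly p a) = coeff p (card L - 1)" if "degree p < card L" for p
      using divided_difference_eq_coeff[OF finL that] by (simp add: d_def)
    define c where "c i = (case i of None \<Rightarrow> -1 | Some a \<Rightarrow> d a)" for i
    have sumL: "(\<Sum>j\<in>Some ` L. c j * monic_values p j) = (\<Sum>a\<in>L. d a * poly p a)" for p
      by (subst sum.reindex) (auto simp: c_def monic_values_def)
    have "(\<Sum>j\<in>J. c j * monic_values p j) = 0" if p: "degree p = n" "lead_coeff p = 1" for p
    proof (cases "None \<in> J")
      case True
      then have JL: "J = insert None (Some ` L)" using J unfolding L_def by force
      then have "card L = n + 1" using J(2) finL by (simp add: card_image)
      then show ?thesis using dd[of p] p sumL[of p] finL by (simp add: JL c_def monic_values_def)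
    next
      case False
      then have JL: "J = Some ` L" using J unfolding L_def by force
      then have "card L = n + 2" using J(2) finL by (simp add: card_image)
      then show ?thesis using dd[of p] p sumL[of p] by (simp add: JL coeff_eq_0)
    qed
    then show "\<exists>c. (\<forall>j\<in>J. c j \<noteq> 0) \<and> (\<forall>v\<in>V. (\<Sum>j\<in>J. c j * v j) = 0)"
      using d0 by (intro exI[of _ c]) (auto simp: V_def c_def split: option.split)
  qed
  then show ?thesis by (fastforce simp: V_def monic_values_def split: option.splits)
qed

section \<open>The characteristic polynomial and the spectrum\<close>

lemma poly_char_poly: "poly (char_poly W) t = det (mat t - W)"
proof -
  have "poly ((\<chi> i j. (if i = j then [:0, 1:] else 0) - [:W $ i $ j:]) $ i $ j) t = (mat t - W) $ i $ j" for i j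
    by (simp add: mat_def)
  moreover have "poly (of_int k) t = of_int k" for k :: int by (simp add: of_int_poly)
  ultimately show ?thesis unfolding char_poly_def det_def poly_sum poly_mult poly_prod by simp
qed

text \<open>
  In the Leibniz formula a permutation contributes a polynomial whose degree is at most the number of
  its fixed points, so only the identity reaches degree \<open>n\<close>.
\<close>

lemma char_poly_monic:
  fixes W :: "'n::finite cmat"
  shows "degree (char_poly W) = CARD('n)" "lead_coeff (char_poly W) = 1"
proof -
  define M where "M i j = (if i = j then [:0, 1:] else 0) - [:W $ i $ j:]" for i j
  define f where "f p = of_int (sign p) * (\<Prod>i\<in>UNIV. M i (p i))" for p
  have cp: "char_poly W = (\<Sum>p | p permutes UNIV. f p)"
    by (simp add: char_poly_def det_def f_def M_def)
  have degM: "degree (M i j) \<le> (if i = j then 1 else 0)" for i j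
    unfolding M_def by (auto intro!: degree_diff_le)
  have degf: "degree (f p) \<le> card {i. p i = i}" for p
  proof -
    have "degree (f p) \<le> degree (of_int (sign p) :: complex poly) + degree (\<Prod>i\<in>UNIV. M i (p i))"
      unfolding f_def by (rule degree_mult_le)
    also have "\<dots> \<le> 0 + (\<Sum>i\<in>UNIV. degree (M i (p i)))"
      using degree_prod_sum_le[of UNIV "\<lambda>i. M i (p i)"] by (intro add_mono) (auto simp: of_int_poly o_def)
    also have "\<dots> \<le> (\<Sum>i\<in>UNIV. if p i = i then 1 else 0)"
      unfolding add_0 using degM by (intro sum_mono) (metis (full_types))
    also have "\<dots> = card {i. p i = i}" by (simp add: sum.If_cases)
    finally show ?thesis .
  qed
  have cf: "coeff (f p) CARD('n) = (if p = id then 1 else 0)" for p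
  proof (cases "p = id")
    case True
    have M: "M i i = [:- W $ i $ i, 1:]" for i by (simp add: M_def)
    have "degree (\<Prod>i\<in>UNIV. M i i) = CARD('n)"
      unfolding M by (subst degree_prod_eq_sum_degree) auto
    moreover have "lead_coeff (\<Prod>i\<in>UNIV. M i i) = 1" unfolding M by (simp add: lead_coeff_prod)
    ultimately show ?thesis using True by (simp add: f_def sign_id)
  next
    case False
    then obtain i where "p i \<noteq> i" by fastforce
    then have "{i. p i = i} \<subset> UNIV" by blast
    then have "card {i. p i = i} < CARD('n)" by (intro psubset_card_mono) auto
    then show ?thesis using degf[of p] False by (simp add: coeff_eq_0)
  qed
  have deg: "degree (char_poly W) \<le> CARD('n)"
    unfolding cp by (intro degree_sum_le finite_permutations order_trans[OF degf] card_mono) auto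
  have "coeff (char_poly W) CARD('n) = (\<Sum>p | p permutes (UNIV :: 'n set). if p = id then 1 else 0)"
    unfolding cp coeff_sum by (simp add: cf)
  also have "\<dots> = 1" by (simp add: finite_permutations permutes_id)
  finally have c1: "coeff (char_poly W) CARD('n) = 1" .
  then show "degree (char_poly W) = CARD('n)" using deg le_degree[of "char_poly W" "CARD('n)"] by simp
  with c1 show "lead_coeff (char_poly W) = 1" by simp
qed

lemma mat_vector_mult: "mat t *v x = t *s (x :: 'a::comm_ring_1 ^ 'n)"
  by (simp add: vec_eq_iff matrix_vector_mult_def mat_def if_distrib[where f = "\<lambda>y. y * _"] cong: if_cong)

lemma spectrum_eq_char_poly_roots: "spectrum W = {t. poly (char_poly W) t = 0}"
proof -
  have "t \<in> spectrum W \<longleftrightarrow> det (mat t - W) = 0" for t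
  proof -
    have "t \<in> spectrum W \<longleftrightarrow> (\<exists>v. v \<noteq> 0 \<and> (mat t - W) *v v = 0)"
      by (auto simp: spectrum_def matrix_vector_mult_diff_rdistrib mat_vector_mult)
    also have "\<dots> \<longleftrightarrow> \<not> invertible (mat t - W)"
      unfolding invertible_left_inverse matrix_left_invertible_ker by blast
    finally show ?thesis by (simp add: invertible_det_nz)
  qed
  then show ?thesis by (auto simp: poly_char_poly)
qed

section \<open>The set of matrices with spectrum in a domain\<close>

text \<open>
  Compare the coordinates of an eigenvector at an index where its modulus is maximal.
\<close>

lemma norm_eigenvalue_le:
  assumes "t \<in> spectrum (W :: 'n::finite cmat)"
  shows "norm t \<le> (\<Sum>i\<in>UNIV. \<Sum>j\<in>UNIV. norm (W $ i $ j))"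
proof -
  obtain v where v: "v \<noteq> 0" "W *v v = t *s v" using assms by (auto simp: spectrum_def)
  obtain i where i: "\<And>j. norm (v $ j) \<le> norm (v $ i)"
    using finite_argmax[of UNIV "\<lambda>j. norm (v $ j)"] by auto
  have vi: "norm (v $ i) > 0"
  proof (rule ccontr)
    assume "\<not> ?thesis"
    then have "v $ j = 0" for j using i[of j] by (smt (verit) norm_ge_zero norm_eq_zero)
    then show False using v(1) by (simp add: vec_eq_iff)
  qed
  have "norm t * norm (v $ i) = norm (\<Sum>j\<in>UNIV. W $ i $ j * v $ j)"
    using arg_cong[OF v(2), of "\<lambda>x. norm (x $ i)"] by (simp add: matrix_vector_mult_def norm_mult)
  also have "\<dots> \<le> (\<Sum>j\<in>UNIV. norm (W $ i $ j) * norm (v $ i))"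
    by (intro sum_norm_le) (simp add: norm_mult i mult_left_mono)
  also have "\<dots> = (\<Sum>j\<in>UNIV. norm (W $ i $ j)) * norm (v $ i)" by (simp add: sum_distrib_right)
  finally have "norm t \<le> (\<Sum>j\<in>UNIV. norm (W $ i $ j))" using vi by simp
  also have "\<dots> \<le> (\<Sum>i\<in>UNIV. \<Sum>j\<in>UNIV. norm (W $ i $ j))"
    by (rule member_le_sum) (auto intro: sum_nonneg)
  finally show ?thesis .
qed

text \<open>
  Eigenvalues outside \<open>\<Omega>\<close> of a convergent sequence of matrices are bounded. They accumulate at a
  zero of the characteristic polynomial of the limit, still outside \<open>\<Omega>\<close>.
\<close>

lemma open_spectral_set:
  assumes "open \<Omega>"
  shows "open (spectral_set \<Omega> :: 'n::finite cmat set)"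
proof -
  have "closed (- spectral_set \<Omega> :: 'n cmat set)"
  proof (subst closed_sequential_limits, intro allI impI, elim conjE)
    fix X and W :: "'n cmat" assume X: "\<forall>k. X k \<in> - spectral_set \<Omega>" and lim: "X \<longlonglongrightarrow> W"
    then have "\<forall>k. \<exists>t. t \<in> spectrum (X k) \<and> t \<notin> \<Omega>" by (auto simp: spectral_set_def)
    then obtain t where t: "\<And>k. t k \<in> spectrum (X k)" "\<And>k. t k \<notin> \<Omega>" by metis
    have ent: "(\<lambda>k. X k $ i $ j) \<longlonglongrightarrow> W $ i $ j" for i j by (intro tendsto_vec_nth lim)
    have "convergent (\<lambda>k. \<Sum>i\<in>UNIV. \<Sum>j\<in>UNIV. norm (X k $ i $ j))"
      unfolding convergent_def
      by (rule exI[of _ "\<Sum>i\<in>UNIV. \<Sum>j\<in>UNIV. norm (W $ i $ j)"]) (intro tendsto_sum tendsto_norm ent)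
    then have "Bseq (\<lambda>k. \<Sum>i\<in>UNIV. \<Sum>j\<in>UNIV. norm (X k $ i $ j))" by (rule convergent_imp_Bseq)
    then obtain B where B: "\<forall>k. norm (\<Sum>i\<in>UNIV. \<Sum>j\<in>UNIV. norm (X k $ i $ j)) \<le> B" by (rule BseqE)
    have "t k \<in> cball 0 B" for k using norm_eigenvalue_le[OF t(1)[of k]] B[rule_format, of k] by simp
    then obtain s r where r: "strict_mono (r :: nat \<Rightarrow> nat)" "(t \<circ> r) \<longlonglongrightarrow> s"
      using compact_cball[of "0::complex" B] unfolding compact_def by metis
    have "s \<notin> \<Omega>" using closed_sequentially[of "- \<Omega>" "t \<circ> r" s] assms t(2) r(2) by (auto simp: closed_Compl)
    have "(\<lambda>k. X (r k) $ i $ j) \<longlonglongrightarrow> W $ i $ j" for i j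
      using LIMSEQ_subseq_LIMSEQ[OF ent r(1)] by (simp add: o_def)
    moreover have "(\<lambda>k. mat (t (r k)) $ i $ j) \<longlonglongrightarrow> mat s $ i $ j" for i j :: 'n
      using r(2) by (cases "i = j") (auto simp: mat_def o_def)
    ultimately have "(\<lambda>k. det (mat (t (r k)) - X (r k))) \<longlonglongrightarrow> det (mat s - W)"
      unfolding det_def vector_minus_component
      by (intro tendsto_sum tendsto_mult tendsto_const tendsto_prod tendsto_diff)
    moreover have "det (mat (t (r k)) - X (r k)) = 0" for k
      using t(1)[of "r k"] by (simp add: spectrum_eq_char_poly_roots poly_char_poly)
    ultimately have "det (mat s - W) = 0" by (simp add: LIMSEQ_const_iff)
    then have "s \<in> spectrum W" by (simp add: spectrum_eq_char_poly_roots poly_char_poly)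
    with \<open>s \<notin> \<Omega>\<close> show "W \<in> - spectral_set \<Omega>" by (auto simp: spectral_set_def)
  qed
  then show ?thesis by (simp add: open_closed)
qed

lemma scaleR_vec_eq_smult: "r *\<^sub>R x = of_real r *s (x :: complex ^ 'n)"
proof -
  have "(r *\<^sub>R x) $ i = of_real r * x $ i" for i
    by (simp only: vector_scaleR_component) (simp add: scaleR_conv_of_real)
  then show ?thesis by (simp add: vec_eq_iff)
qed

lemma scaleR_cmat_mult: "(r *\<^sub>R W) *v x = of_real r *s ((W :: 'n::finite cmat) *v x)"
proof -
  have "(r *\<^sub>R W) $ i $ j = of_real r * W $ i $ j" for i j
    by (simp only: vector_scaleR_component) (simp add: scaleR_conv_of_real)
  then show ?thesis by (simp add: vec_eq_iff matrix_vector_mult_def sum_distrib_left mult.assoc)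
qed

text \<open>
  The component \<open>z\<close> of \<open>v\<close> orthogonal to \<open>K\<close> gives the functional. It is orthogonal for the real inner
  product, and because \<open>K\<close> is also closed under multiplication by \<open>\<i>\<close>, for the Hermitian one.
\<close>

lemma separating_functional:
  fixes K :: "(complex ^ 'n::finite) set"
  assumes add: "\<And>x y. x \<in> K \<Longrightarrow> y \<in> K \<Longrightarrow> x + y \<in> K" and scale: "\<And>c x. x \<in> K \<Longrightarrow> c *s x \<in> K"
    and zero: "0 \<in> K" and v: "v \<notin> K"
  obtains w :: "'n \<Rightarrow> complex"
    where "(\<Sum>j\<in>UNIV. w j * v $ j) = 1" "\<And>x. x \<in> K \<Longrightarrow> (\<Sum>j\<in>UNIV. w j * x $ j) = 0"
proof -
  have sub: "span K = K"
    by (rule span_eq_iff[THEN iffD2]) (auto simp: subspace_def zero add scaleR_vec_eq_smult scale)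
  obtain y z where y: "y \<in> span K" and z: "\<And>x. x \<in> span K \<Longrightarrow> orthogonal z x" and vyz: "v = y + z"
    using orthogonal_subspace_decomp_exists[of K v] by metis
  have Re_eq: "Re (\<Sum>j\<in>UNIV. cnj (z $ j) * x $ j) = z \<bullet> x" for x
    by (simp add: inner_vec_def inner_complex_def)
  have Im_eq: "Im (\<Sum>j\<in>UNIV. cnj (z $ j) * x $ j) = - (z \<bullet> (\<i> *s x))" for x
    by (simp add: inner_vec_def inner_complex_def sum_negf[symmetric] algebra_simps)
  have orth: "(\<Sum>j\<in>UNIV. cnj (z $ j) * x $ j) = 0" if "x \<in> K" for x
  proof (rule complex_eqI)
    show "Re (\<Sum>j\<in>UNIV. cnj (z $ j) * x $ j) = Re 0"
      unfolding Re_eq using z[of x] that sub by (simp add: orthogonal_def)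
    show "Im (\<Sum>j\<in>UNIV. cnj (z $ j) * x $ j) = Im 0"
      unfolding Im_eq using z[of "\<i> *s x"] scale[OF that] sub by (simp add: orthogonal_def)
  qed
  define \<alpha> where "\<alpha> = (\<Sum>j\<in>UNIV. cnj (z $ j) * v $ j)"
  have "z \<noteq> 0" using v vyz y sub by auto
  moreover have "Re \<alpha> = z \<bullet> z" using z[OF y] unfolding \<alpha>_def Re_eq vyz by (simp add: inner_add_right orthogonal_def)
  ultimately have "\<alpha> \<noteq> 0" by auto
  show ?thesis
  proof
    show "(\<Sum>j\<in>UNIV. cnj (z $ j) / \<alpha> * v $ j) = 1"
      using \<open>\<alpha> \<noteq> 0\<close> by (simp add: \<alpha>_def sum_divide_distrib[symmetric])
    show "(\<Sum>j\<in>UNIV. cnj (z $ j) / \<alpha> * x $ j) = 0" if "x \<in> K" for x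
      using orth[OF that] by (simp add: sum_divide_distrib[symmetric])
  qed
qed

definition rank_one :: "complex ^ 'n \<Rightarrow> ('n \<Rightarrow> complex) \<Rightarrow> 'n::finite cmat" where
  "rank_one v w = (\<chi> i j. v $ i * w j)"

lemma rank_one_mult: "cscale_mat c (rank_one v w) *v x = (c * (\<Sum>j\<in>UNIV. w j * x $ j)) *s v"
  by (simp add: vec_eq_iff matrix_vector_mult_def cscale_mat_def rank_one_def sum_distrib_left sum_distrib_right mult_ac)

text \<open>
  Brauer's theorem: adding \<open>c\<close> times the projection to \<open>v\<close> along the kernel of \<open>w\<close> moves the
  eigenvalue of \<open>v\<close> by \<open>c\<close> and creates no other new eigenvalue.
\<close>

lemma spectrum_rank_one_update:
  fixes W :: "'n::finite cmat"
  assumes ev: "W *v v = l *s v" and w: "(\<Sum>j\<in>UNIV. w j * v $ j) = 1"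
  shows "spectrum (W + cscale_mat c (rank_one v w)) \<subseteq> insert (l + c) (spectrum W)"
proof
  fix t assume "t \<in> spectrum (W + cscale_mat c (rank_one v w))"
  then obtain x where x: "x \<noteq> 0" "(W + cscale_mat c (rank_one v w)) *v x = t *s x"
    by (auto simp: spectrum_def)
  define s where "s = (\<Sum>j\<in>UNIV. w j * x $ j)"
  have Wx: "W *v x = t *s x - (c * s) *s v"
    using x(2) by (simp add: matrix_vector_mult_add_rdistrib rank_one_mult s_def algebra_simps)
  show "t \<in> insert (l + c) (spectrum W)"
  proof (rule ccontr)
    assume "t \<notin> insert (l + c) (spectrum W)"
    then have t: "t \<noteq> l + c" and inj: "\<And>y. W *v y = t *s y \<Longrightarrow> y = 0"
      by (auto simp: spectrum_def)
    have "W *v ((t - l) *s x - (c * s) *s v) = (t - l) *s (W *v x) - (c * s) *s (W *v v)"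
      by (simp add: matrix_vector_mult_diff_distrib vector_scalar_commute)
    also have "\<dots> = t *s ((t - l) *s x - (c * s) *s v)"
      by (simp add: Wx ev vec_eq_iff algebra_simps)
    finally have eq: "(t - l) *s x = (c * s) *s v" using inj by fastforce
    have "(t - l) * s = (\<Sum>j\<in>UNIV. w j * ((t - l) *s x) $ j)"
      by (simp add: s_def sum_distrib_left algebra_simps)
    also have "\<dots> = c * s * (\<Sum>j\<in>UNIV. w j * v $ j)"
      unfolding eq by (simp add: sum_distrib_left mult_ac)
    finally have "(t - (l + c)) * s = 0" using w by (simp add: algebra_simps)
    then have "s = 0" using t by simp
    then show False using Wx inj[of x] x(1) by simp
  qed
qed

text \<open>
  While \<open>W\<close> has an eigenvalue \<open>l \<noteq> l0\<close>, a rank-one update moves it to \<open>l0\<close> along a path in \<open>\<Omega>\<close>. The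
  functional is chosen to vanish on the eigenspace of \<open>l0\<close>, so this eigenspace survives and gains the
  vector \<open>v\<close>; hence the process ends. When \<open>l0\<close> is the only eigenvalue left, it is the only
  eigenvalue on the whole segment to the scalar matrix.
\<close>

lemma path_component_to_scalar_matrix:
  fixes W :: "'n::finite cmat"
  assumes \<Omega>: "path_connected \<Omega>" and l0: "l0 \<in> \<Omega>" and W: "W \<in> spectral_set \<Omega>"
  shows "path_component (spectral_set \<Omega>) W (mat l0)"
  using W
proof (induction W rule: measure_induct_rule[where f = "\<lambda>W. DIM(complex ^ 'n) - dim {x. W *v x = l0 *s x}"])
  case (less W)
  let ?S = "spectral_set \<Omega> :: 'n cmat set"
  show ?case
  proof (cases "spectrum W \<subseteq> {l0}")
    case True
    have "(1 - s) *\<^sub>R W + s *\<^sub>R mat l0 \<in> ?S" for s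
    proof -
      have "t = l0" if "t \<in> spectrum ((1 - s) *\<^sub>R W + s *\<^sub>R mat l0)" for t
      proof -
        from that have "\<exists>x. x \<noteq> 0 \<and> ((1 - s) *\<^sub>R W + s *\<^sub>R mat l0) *v x = t *s x"
          by (simp only: spectrum_def mem_Collect_eq)
        then obtain x where x: "x \<noteq> 0" "((1 - s) *\<^sub>R W + s *\<^sub>R mat l0) *v x = t *s x"
          by (elim exE conjE)
        have eq: "of_real (1 - s) *s (W *v x) = (t - of_real s * l0) *s x"
        proof -
          have "of_real (1 - s) *s (W *v x) + of_real s *s (l0 *s x) = t *s x"
            using x(2) by (simp only: matrix_vector_mult_add_rdistrib scaleR_cmat_mult mat_vector_mult)
          then show ?thesis by (simp add: vec_eq_iff left_diff_distrib mult.assoc eq_diff_eq del: of_real_diff)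
        qed
        show ?thesis
        proof (cases "s = 1")
          case True
          then have "(t - l0) *s x = 0" using eq by (simp add: vec_eq_iff)
          then show ?thesis using x(1) by (simp add: vector_mul_eq_0)
        next
          case False
          define u where "u = (t - of_real s * l0) / of_real (1 - s)"
          have s1: "of_real (1 - s) \<noteq> (0::complex)" using False by (simp only: of_real_eq_0_iff right_minus_eq not_sym simp_thms)
          have tu: "t - of_real s * l0 = of_real (1 - s) * u" using s1 by (simp add: u_def)
          have "(W *v x) $ i = (u *s x) $ i" for i
            using arg_cong[OF eq, of "\<lambda>y. y $ i"] s1 unfolding tu by (simp add: mult.assoc del: of_real_diff)
          then have "W *v x = u *s x" by (simp add: vec_eq_iff)
          then have "u \<in> spectrum W" using x(1) by (auto simp: spectrum_def)
          then have "u = l0" using True by auto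
          then show ?thesis using tu by (simp add: algebra_simps)
        qed
      qed
      then show ?thesis using l0 by (auto simp: spectral_set_def)
    qed
    then have "closed_segment W (mat l0) \<subseteq> ?S" by (auto simp: closed_segment_def)
    then show ?thesis by (rule path_component_linepath)
  next
    case False
    then obtain l v where l: "l \<in> spectrum W" "l \<noteq> l0" and v: "v \<noteq> 0" "W *v v = l *s v"
      by (auto simp: spectrum_def)
    define K where "K U = {x. U *v x = l0 *s x}" for U :: "'n cmat"
    have vK: "v \<notin> K W"
    proof
      assume "v \<in> K W"
      then have "(l - l0) *s v = 0" using v(2) by (simp add: K_def vec_eq_iff algebra_simps)
      then show False using v(1) l(2) by (simp add: vector_mul_eq_0)
    qed
    obtain w where w: "(\<Sum>j\<in>UNIV. w j * v $ j) = 1" "\<And>x. x \<in> K W \<Longrightarrow> (\<Sum>j\<in>UNIV. w j * x $ j) = 0"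
      by (rule separating_functional[of "K W" v])
        (use vK in \<open>auto simp: K_def matrix_vector_right_distrib vector_scalar_commute vector_add_ldistrib
            vector_smult_assoc mult.commute\<close>)
    define Z where "Z c = W + cscale_mat c (rank_one v w)" for c
    have lO: "l \<in> \<Omega>" using less.prems l(1) by (auto simp: spectral_set_def)
    obtain g where g: "path g" "path_image g \<subseteq> \<Omega>" "pathstart g = l" "pathfinish g = l0"
      using \<Omega> l0 lO unfolding path_connected_def by blast
    have ZS: "Z (\<mu> - l) \<in> ?S" if "\<mu> \<in> \<Omega>" for \<mu>
      using spectrum_rank_one_update[OF v(2) w(1), of "\<mu> - l"] that less.prems
      by (auto simp: Z_def spectral_set_def)
    have "path_component ?S W (Z (l0 - l))"
      unfolding path_component_def
    proof (intro exI[of _ "\<lambda>s. Z (g s - l)"] conjI)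
      have "continuous_on {0..1} g" using g(1) by (simp add: path_def)
      then show "path (\<lambda>s. Z (g s - l))"
        unfolding path_def Z_def cscale_mat_def by (intro continuous_intros)
      show "path_image (\<lambda>s. Z (g s - l)) \<subseteq> ?S" using g(2) ZS by (auto simp: path_image_def)
      show "pathstart (\<lambda>s. Z (g s - l)) = W"
        using g(3) by (simp add: pathstart_def Z_def cscale_mat_def vec_eq_iff)
      show "pathfinish (\<lambda>s. Z (g s - l)) = Z (l0 - l)" using g(4) by (simp add: pathfinish_def)
    qed
    moreover have "path_component ?S (Z (l0 - l)) (mat l0)"
    proof (rule less.IH)
      have Zx: "Z c *v x = W *v x + (c * (\<Sum>j\<in>UNIV. w j * x $ j)) *s v" for c x
        by (simp add: Z_def matrix_vector_mult_add_rdistrib rank_one_mult)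
      have sub: "span (K U) = K U" for U
        by (rule span_eq_iff[THEN iffD2]) (auto simp: subspace_def K_def scaleR_vec_eq_smult
            matrix_vector_right_distrib vector_scalar_commute vector_add_ldistrib vector_smult_assoc mult.commute)
      have "K W \<subseteq> K (Z (l0 - l))" using w(2) by (auto simp: K_def Zx)
      moreover have "v \<in> K (Z (l0 - l))" using v(2) w(1) by (simp add: K_def Zx vec_eq_iff algebra_simps)
      ultimately have "span (K W) \<subset> span (K (Z (l0 - l)))" using vK sub by blast
      then have "dim (K W) < dim (K (Z (l0 - l)))" by (rule dim_psubset)
      moreover have "dim (K (Z (l0 - l))) \<le> DIM(complex ^ 'n)" by (rule dim_subset_UNIV)
      ultimately show "DIM(complex ^ 'n) - dim {x. Z (l0 - l) *v x = l0 *s x} <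
          DIM(complex ^ 'n) - dim {x. W *v x = l0 *s x}" unfolding K_def by linarith
      show "Z (l0 - l) \<in> ?S" by (rule ZS[OF l0])
    qed
    ultimately show ?thesis by (rule path_component_trans)
  qed
qed

lemma connected_spectral_set:
  assumes "open \<Omega>" "connected \<Omega>" "\<Omega> \<noteq> {}"
  shows "connected (spectral_set \<Omega> :: 'n::finite cmat set)"
proof -
  obtain l0 where l0: "l0 \<in> \<Omega>" using assms by blast
  have pc: "path_connected \<Omega>" using assms connected_open_path_connected by blast
  have "path_connected (spectral_set \<Omega> :: 'n cmat set)"
    unfolding path_connected_component
  proof (intro ballI)
    fix V W :: "'n cmat" assume "V \<in> spectral_set \<Omega>" "W \<in> spectral_set \<Omega>"
    then show "path_component (spectral_set \<Omega>) V W"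
      by (intro path_component_trans[OF path_component_to_scalar_matrix[OF pc l0]
            path_component_sym[OF path_component_to_scalar_matrix[OF pc l0]]])
  qed
  then show ?thesis by (rule path_connected_imp_connected)
qed

section \<open>The Schwarz lemma with order of vanishing\<close>

lemma Schwarz_ball:
  assumes hol: "f holomorphic_on ball 0 d" and d: "0 < d" and f0: "f 0 = 0"
    and bd: "\<And>z. z \<in> ball 0 d \<Longrightarrow> norm (f z) \<le> M" and z: "z \<in> ball 0 d"
  shows "norm (f z) \<le> M * (norm z / d)"
proof (rule field_le_epsilon)
  fix e :: real assume e: "0 < e"
  have M: "0 \<le> M" using bd[of 0] d by (simp add: f0)
  define g where "g w = f (of_real d * w) / of_real (M + e)" for w
  have inb: "of_real d * w \<in> ball 0 d" if "norm w < 1" for w :: complex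
    using that d by (simp add: norm_mult)
  have "norm (g (z / of_real d)) \<le> norm (z / of_real d)"
  proof (rule Schwarz_Lemma(1))
    have "(\<lambda>w. f (of_real d * w)) holomorphic_on ball 0 1"
      using inb by (intro holomorphic_on_compose_gen[OF _ hol, unfolded o_def] holomorphic_intros) auto
    then show "g holomorphic_on ball 0 1"
      unfolding g_def using M e by (intro holomorphic_intros) (auto simp flip: of_real_add)
    show "g 0 = 0" by (simp add: g_def f0)
    show "norm (g w) < 1" if "norm w < 1" for w
    proof -
      have "norm (f (of_real d * w)) < M + e" using bd[OF inb[OF that]] e by simp
      then show ?thesis using M e unfolding g_def norm_divide norm_of_real by simp
    qed
    show "norm (z / of_real d) < 1" using z d by (simp add: norm_divide)
  qed
  moreover have "of_real d * (z / of_real d) = z" using d by simp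
  ultimately have "norm (f z) / (M + e) \<le> norm z / d"
    using M e d unfolding g_def norm_divide norm_of_real by simp
  then have "norm (f z) \<le> (M + e) * (norm z / d)" using M e by (simp add: pos_divide_le_eq mult.commute)
  also have "\<dots> = M * (norm z / d) + e * (norm z / d)" by (simp add: algebra_simps add_divide_distrib)
  also have "e * (norm z / d) \<le> e * 1" using z d e by (intro mult_left_mono) auto
  finally show "norm (f z) \<le> M * (norm z / d) + e" by simp
qed

text \<open>
  The Schwarz lemma for \<open>f z / z ^ m\<close>.
\<close>

lemma Schwarz_raise_order:
  assumes hol: "f holomorphic_on ball 0 d" and d: "0 < d"
    and bd: "\<And>z. z \<in> ball 0 d \<Longrightarrow> norm (f z) \<le> B * (norm z / d) ^ m"
    and lim: "(\<lambda>z. f z / z ^ m) \<midarrow>0\<rightarrow> 0" and z: "z \<in> ball 0 d"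
  shows "norm (f z) \<le> B * (norm z / d) ^ Suc m"
proof -
  define q where "q z = (if z = 0 then 0 else f z / z ^ m)" for z
  have "q \<midarrow>0\<rightarrow> 0"
    by (rule Lim_transform_eventually[OF lim]) (auto simp: q_def eventually_at intro!: exI[of _ 1])
  then have q0: "(q \<longlongrightarrow> q 0) (at 0 within ball 0 d)"
    by (simp add: q_def tendsto_within_subset[where S = UNIV])
  have "(\<lambda>z. f z / z ^ m) holomorphic_on (ball 0 d - {0})"
    using holomorphic_on_subset[OF hol, of "ball 0 d - {0}"] by (intro holomorphic_intros) auto
  then have "q holomorphic_on (ball 0 d - {0})"
    by (rule holomorphic_transform) (simp add: q_def)
  then have holq: "q holomorphic_on ball 0 d"
    by (rule no_isolated_singularity'[rotated]) (use q0 in simp_all)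
  have B: "0 \<le> B"
  proof -
    have "norm (f (of_real (d / 2))) \<le> B * (norm (of_real (d / 2) :: complex) / d) ^ m"
      using d by (intro bd) (simp add: norm_divide)
    also have "norm (of_real (d / 2) :: complex) / d = 1 / 2" using d by (simp only: norm_of_real) simp
    finally have "0 \<le> B * (1 / 2) ^ m" by (rule order_trans[OF norm_ge_zero])
    then have "0 * (1 / 2) ^ m \<le> B * (1 / 2) ^ m" by simp
    then show ?thesis by (rule mult_right_le_imp_le) simp
  qed
  have "norm (q z) \<le> B / d ^ m * (norm z / d)"
  proof (rule Schwarz_ball[OF holq d _ _ z])
    show "q 0 = 0" by (simp add: q_def)
    fix w :: complex assume w: "w \<in> ball 0 d"
    show "norm (q w) \<le> B / d ^ m"
    proof (cases "w = 0")
      case False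
      then show ?thesis using bd[OF w] d
        by (simp add: q_def norm_divide norm_power power_divide field_simps)
    qed (use B d in \<open>simp add: q_def\<close>)
  qed
  show ?thesis
  proof (cases "z = 0")
    case False
    then have "norm (f z) = norm (q z) * norm z ^ m" by (simp add: q_def norm_divide norm_power)
    also have "\<dots> \<le> B / d ^ m * (norm z / d) * norm z ^ m"
      using \<open>norm (q z) \<le> _\<close> by (intro mult_right_mono) auto
    finally show ?thesis by (simp add: power_divide field_simps)
  next
    case True
    have "f 0 = 0"
    proof (cases m)
      case 0
      have "f \<midarrow>0\<rightarrow> f 0"
        using holomorphic_on_imp_continuous_on[OF hol] d
        by (metis centre_in_ball continuous_on_eq_continuous_at continuous_within open_ball)
      then show ?thesis using lim 0 by (intro LIM_unique[where f = f and a = 0]) auto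
    next
      case (Suc k)
      then show ?thesis using bd[of 0] d by simp
    qed
    then show ?thesis using True by simp
  qed
qed

section \<open>Holomorphic maps of matrices along complex lines\<close>

lemma norm_cscale_mat: "norm (cscale_mat c X) = norm c * norm X"
proof -
  have row: "norm (\<chi> j. c * x $ j) = norm c * norm x" for x :: "complex ^ 'n"
    by (simp add: norm_vec_def norm_mult L2_set_right_distrib)
  have "norm (cscale_mat c X) = L2_set (\<lambda>i. norm (cscale_mat c X $ i)) UNIV"
    by (rule norm_vec_def)
  also have "\<dots> = L2_set (\<lambda>i. norm c * norm (X $ i)) UNIV"
    by (simp add: cscale_mat_def row)
  also have "\<dots> = norm c * norm X" by (simp add: norm_vec_def[of X] L2_set_right_distrib)
  finally show ?thesis .
qed

lemma cscale_mat_simps: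
  "cscale_mat c (cscale_mat d X) = cscale_mat (c * d) X"
  "cscale_mat 1 X = X" "cscale_mat 0 X = 0"
  "cscale_mat (c + d) X = cscale_mat c X + cscale_mat d X"
  by (simp_all add: cscale_mat_def vec_eq_iff algebra_simps)

lemma holomorphic_map_derivative:
  assumes "F holomorphic_map_on S" "open S" "W \<in> S"
  obtains D where "(F has_derivative D) (at W)" "\<And>c X. D (cscale_mat c X) = cscale_mat c (D X)"
  using assms at_within_open[OF assms(3,2)]
  unfolding holomorphic_map_on_def has_complex_derivative_def by metis

lemma holomorphic_map_compose:
  assumes F: "F holomorphic_map_on S" and G: "G holomorphic_map_on S" and S: "open S" and FS: "F \<in> S \<rightarrow> S"
  shows "(\<lambda>W. G (F W)) holomorphic_map_on S"
  unfolding holomorphic_map_on_def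
proof
  fix W assume W: "W \<in> S"
  obtain D where D: "(F has_derivative D) (at W)" "\<And>c X. D (cscale_mat c X) = cscale_mat c (D X)"
    by (rule holomorphic_map_derivative[OF F S W]) blast
  have "F W \<in> S" using FS W by blast
  then obtain D' where D': "(G has_derivative D') (at (F W))" "\<And>c X. D' (cscale_mat c X) = cscale_mat c (D' X)"
    using holomorphic_map_derivative[OF G S] by blast
  have "((\<lambda>W. G (F W)) has_derivative (\<lambda>X. D' (D X))) (at W)"
    by (rule has_derivative_compose[OF D(1) D'(1)])
  then show "\<exists>D. ((\<lambda>W. G (F W)) has_complex_derivative D) (at W within S)"
    using D(2) D'(2) at_within_open[OF W S] by (auto simp: has_complex_derivative_def)
qed

lemma holomorphic_map_funpow:
  assumes F: "F holomorphic_map_on S" and S: "open S" and FS: "F \<in> S \<rightarrow> S"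
  shows "(F ^^ k) holomorphic_map_on S \<and> (F ^^ k) \<in> S \<rightarrow> S"
proof (induction k)
  case 0
  have "((\<lambda>W. W) has_complex_derivative (\<lambda>X. X)) (at W within S)" for W
    by (simp add: has_complex_derivative_def)
  then show ?case by (auto simp: holomorphic_map_on_def id_def)
next
  case (Suc k)
  have "(\<lambda>W. F ((F ^^ k) W)) holomorphic_map_on S"
    by (rule holomorphic_map_compose[OF _ F S]) (use Suc in auto)
  moreover have "(F ^^ Suc k) = (\<lambda>W. F ((F ^^ k) W))" by auto
  ultimately show ?case using Suc FS by (auto simp: Pi_iff)
qed

lemma bounded_linear_cscale_mat_left: "bounded_linear (\<lambda>z. cscale_mat z Q)"
proof (rule linear_conv_bounded_linear[THEN iffD1], rule linearI)
  show "cscale_mat (a + b) Q = cscale_mat a Q + cscale_mat b Q" for a b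
    by (rule cscale_mat_simps)
  show "cscale_mat (r *\<^sub>R a) Q = r *\<^sub>R cscale_mat a Q" for r a
  proof -
    have "(r *\<^sub>R cscale_mat a Q) $ i $ j = (r *\<^sub>R a) * Q $ i $ j" for i j
      by (simp only: vector_scaleR_component) (simp add: cscale_mat_def)
    then show ?thesis by (simp add: vec_eq_iff cscale_mat_def)
  qed
qed

lemma holomorphic_on_entry_along_line:
  assumes F: "F holomorphic_map_on S" and S: "open S" and U: "open U"
    and line: "\<And>z. z \<in> U \<Longrightarrow> P + cscale_mat z Q \<in> S"
  shows "(\<lambda>z. F (P + cscale_mat z Q) $ i $ j) holomorphic_on U"
proof (rule holomorphic_onI)
  fix z assume z: "z \<in> U"
  obtain D where D: "(F has_derivative D) (at (P + cscale_mat z Q))"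
      "\<And>c X. D (cscale_mat c X) = cscale_mat c (D X)"
    by (rule holomorphic_map_derivative[OF F S line[OF z]]) blast
  have "((\<lambda>z. P + cscale_mat z Q) has_derivative (\<lambda>h. cscale_mat h Q)) (at z)"
    using bounded_linear_imp_has_derivative[OF bounded_linear_cscale_mat_left]
    by (auto intro!: derivative_eq_intros)
  from has_derivative_compose[OF this D(1)]
  have "((\<lambda>z. F (P + cscale_mat z Q)) has_derivative (\<lambda>h. cscale_mat h (D Q))) (at z)"
    by (simp add: D(2))
  then have "((\<lambda>z. F (P + cscale_mat z Q) $ i $ j) has_derivative (\<lambda>h. cscale_mat h (D Q) $ i $ j)) (at z)"
    by (intro bounded_linear.has_derivative[OF bounded_linear_vec_nth])
  moreover have "(\<lambda>h. cscale_mat h (D Q) $ i $ j) = (*) (D Q $ i $ j)"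
    by (simp add: fun_eq_iff cscale_mat_def mult.commute)
  ultimately have "((\<lambda>z. F (P + cscale_mat z Q) $ i $ j) has_field_derivative D Q $ i $ j) (at z)"
    unfolding has_field_derivative_def by (simp only:)
  then show "(\<lambda>z. F (P + cscale_mat z Q) $ i $ j) field_differentiable at z within U"
    using field_differentiable_def field_differentiable_at_within by blast
qed

lemma holomorphic_on_char_poly_along_line:
  assumes F: "F holomorphic_map_on S" and S: "open S" and U: "open U"
    and line: "\<And>z. z \<in> U \<Longrightarrow> P + cscale_mat z Q \<in> S"
  shows "(\<lambda>z. poly (char_poly (F (P + cscale_mat z Q))) a) holomorphic_on U"
  unfolding poly_char_poly det_def vector_minus_component
  by (intro holomorphic_on_sum holomorphic_on_mult holomorphic_on_prod holomorphic_on_diff holomorphic_on_const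
      holomorphic_on_entry_along_line[OF assms]) auto

section \<open>Uniform bounds for characteristic polynomials\<close>

text \<open>
  On each line through \<open>A\<close> Schottky's theorem applies to logarithms of the values of the
  characteristic polynomials. At \<open>A\<close> these values are independent of \<open>k\<close>, so its bound is also
  independent of \<open>k\<close> and of the line. It compares the values with the
  constant \<open>1\<close>, the value with index \<open>None\<close>.
\<close>

lemma char_poly_values_uniformly_bounded:
  fixes \<Phi> :: "nat \<Rightarrow> 'n::finite cmat \<Rightarrow> 'n cmat"
  assumes T: "finite T" "card T = 2 * CARD('n)" "T \<inter> \<Omega> = {}"
    and S: "open S" and hol: "\<And>k. \<Phi> k holomorphic_map_on S" and \<Phi>S: "\<And>k W. W \<in> S \<Longrightarrow> \<Phi> k W \<in> spectral_set \<Omega>"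
    and fixA: "\<And>k. \<Phi> k A = A" and r: "0 < r" "ball A r \<subseteq> S"
  shows "\<exists>M. \<forall>k. \<forall>W\<in>ball A (r / 4). \<forall>a\<in>T. norm (poly (char_poly (\<Phi> k W)) a) \<le> M"
proof -
  define I where "I = insert None (Some ` T)"
  have I: "finite I" "I \<noteq> {}" using T by (auto simp: I_def)
  have AS: "A \<in> S" using r by auto
  obtain C where C: "\<And>p. degree p = CARD('n) \<Longrightarrow> lead_coeff p = 1 \<Longrightarrow> (\<And>a. a \<in> T \<Longrightarrow> poly p a \<noteq> 0) \<Longrightarrow>
      majority_near_max C I (\<lambda>i. ln (norm (monic_values p i)))"
    using majority_of_monic_values[OF T(1,2)] unfolding I_def by blast
  define B where "B = (\<Sum>i\<in>I. \<bar>ln (norm (monic_values (char_poly A) i))\<bar>)"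
  obtain M where M: "\<And>g z i j. (\<forall>i\<in>I. g i holomorphic_on ball 0 1) \<and>
           (\<forall>z\<in>ball 0 1. majority_near_max C I (\<lambda>i. Re (g i z))) \<and>
           (\<forall>i\<in>I. \<forall>j\<in>I. \<bar>Re (g i 0 - g j 0)\<bar> \<le> 2 * B) \<Longrightarrow>
           z \<in> ball 0 (1/4) \<Longrightarrow> i \<in> I \<Longrightarrow> j \<in> I \<Longrightarrow> \<bar>Re (g i z - g j z)\<bar> \<le> M"
    using schottky_majority[OF I, of C "2 * B"] by blast
  have nz: "poly (char_poly (\<Phi> k W)) a \<noteq> 0" if "W \<in> S" "a \<in> T" for k W a
    using \<Phi>S[OF that(1), of k] that(2) T(3) by (auto simp: spectral_set_def spectrum_eq_char_poly_roots)
  show ?thesis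
  proof (intro exI[of _ "exp M"] allI ballI)
    fix k W a assume W: "W \<in> ball A (r / 4)" and a: "a \<in> T"
    obtain X c where X: "norm X \<le> r" and c: "norm c < 1 / 4" and WX: "W = A + cscale_mat c X"
    proof
      show "norm (cscale_mat (of_real r / of_real (norm (W - A))) (W - A)) \<le> r"
        using r(1) by (simp add: norm_cscale_mat norm_divide)
      show "norm (complex_of_real (norm (W - A)) / of_real r) < 1 / 4"
        using W r(1) by (simp add: norm_divide dist_norm norm_minus_commute field_simps)
      show "W = A + cscale_mat (complex_of_real (norm (W - A)) / of_real r)
          (cscale_mat (of_real r / of_real (norm (W - A))) (W - A))"
        using r(1) by (cases "W = A") (auto simp: cscale_mat_simps)
    qed
    have inS: "A + cscale_mat z X \<in> S" if "z \<in> ball 0 1" for z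
    proof -
      have "norm (cscale_mat z X) < r"
      proof -
        have "norm z * norm X \<le> norm z * r" using X by (intro mult_left_mono) auto
        also have "\<dots> < 1 * r" using that r(1) by (intro mult_strict_right_mono) auto
        finally show ?thesis by (simp add: norm_cscale_mat)
      qed
      then show ?thesis using r(2) by (auto simp: dist_norm)
    qed
    define u where "u i z = monic_values (char_poly (\<Phi> k (A + cscale_mat z X))) i" for i z
    have holu: "u i holomorphic_on ball 0 1" for i
      unfolding u_def monic_values_def
      by (cases i) (auto intro!: holomorphic_on_char_poly_along_line[OF hol S] inS)
    have u0: "u i z \<noteq> 0" if "i \<in> I" "z \<in> ball 0 1" for i z
      using nz[OF inS[OF that(2)]] that(1) by (auto simp: u_def monic_values_def I_def)
    have "\<exists>g. g holomorphic_on ball 0 1 \<and> (\<forall>z\<in>ball 0 1. exp (g z) = u i z)" if "i \<in> I" for i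
      by (rule holomorphic_logarithm_exists[OF convex_ball open_ball holu u0[OF that], of 0]) auto
    then obtain g where g: "\<And>i. i \<in> I \<Longrightarrow> g i holomorphic_on ball 0 1"
        "\<And>i z. i \<in> I \<Longrightarrow> z \<in> ball 0 1 \<Longrightarrow> exp (g i z) = u i z"
      by metis
    have Re_g: "Re (g i z) = ln (norm (u i z))" if "i \<in> I" "z \<in> ball 0 1" for i z
      unfolding g(2)[OF that, symmetric] by simp
    have maj: "majority_near_max C I (\<lambda>i. Re (g i z))" if z: "z \<in> ball 0 1" for z
    proof -
      have "majority_near_max C I (\<lambda>i. ln (norm (u i z)))"
        unfolding u_def by (rule C) (use char_poly_monic nz[OF inS[OF z]] in auto)
      moreover have "near_max C I (\<lambda>i. Re (g i z)) = near_max C I (\<lambda>i. ln (norm (u i z)))"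
        using Re_g z by (auto simp: near_max_def)
      ultimately show ?thesis by (simp add: majority_near_max_def)
    qed
    have at0: "\<bar>Re (g i 0)\<bar> \<le> B" if "i \<in> I" for i
    proof -
      have "Re (g i 0) = ln (norm (monic_values (char_poly A) i))"
        using Re_g[OF that, of 0] by (simp add: u_def cscale_mat_simps fixA)
      then show ?thesis unfolding B_def using member_le_sum[OF that, of "\<lambda>i. \<bar>ln (norm (monic_values (char_poly A) i))\<bar>"] I
        by simp
    qed
    have "\<bar>Re (g (Some a) c - g None c)\<bar> \<le> M"
    proof (rule M)
      show "(\<forall>i\<in>I. g i holomorphic_on ball 0 1) \<and>
           (\<forall>z\<in>ball 0 1. majority_near_max C I (\<lambda>i. Re (g i z))) \<and>
           (\<forall>i\<in>I. \<forall>j\<in>I. \<bar>Re (g i 0 - g j 0)\<bar> \<le> 2 * B)"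
      proof (intro conjI ballI)
        fix i j assume "i \<in> I" "j \<in> I"
        then show "\<bar>Re (g i 0 - g j 0)\<bar> \<le> 2 * B" using at0[of i] at0[of j] by simp
      qed (use g maj in auto)
    qed (use c a in \<open>auto simp: I_def\<close>)
    moreover have c1: "c \<in> ball 0 1" using c by simp
    moreover have "Re (g None c) = 0" using Re_g[of None c] c1 by (simp add: I_def u_def monic_values_def)
    ultimately have "Re (g (Some a) c) \<le> M" by simp
    moreover have "norm (u (Some a) c) = exp (Re (g (Some a) c))"
      using g(2)[of "Some a" c] c1 a norm_exp_eq_Re[of "g (Some a) c"] by (simp add: I_def)
    ultimately have "norm (u (Some a) c) \<le> exp M" by simp
    then show "norm (poly (char_poly (\<Phi> k W)) a) \<le> exp M" by (simp add: u_def monic_values_def WX)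
  qed
qed

section \<open>Maps tangent to the identity\<close>

text \<open>
  The heart of Cartan's uniqueness theorem, for a function \<open>E\<close> whose sums along the orbits of maps
  \<open>f l\<close> tangent to the identity are bounded. By induction on \<open>m\<close>, \<open>E\<close> vanishes at \<open>A\<close> to order \<open>m\<close>
  along all lines, with a bound that is a geometric sequence in \<open>m\<close>: if \<open>E\<close> has order \<open>m\<close>, then
  on a line \<open>E (f l (L z)) / z ^ m\<close> and \<open>E (L z) / z ^ m\<close> have the same limit at \<open>0\<close>, so the sum of
  \<open>k\<close> terms is about \<open>k E (L z)\<close>. It is bounded by \<open>B (|z| / d) ^ m\<close> independently of \<open>k\<close>, so this
  limit is \<open>0\<close>.
\<close>

lemma vanishing_of_bounded_orbit_sums:
  fixes E :: "'n::finite cmat \<Rightarrow> complex" and f :: "nat \<Rightarrow> 'n cmat \<Rightarrow> 'n cmat"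
  assumes d: "0 < d" and f0: "\<And>W. f 0 W = W"
    and der: "\<And>l. (f l has_derivative id) (at A)" and fA: "\<And>l. f l A = A"
    and hol: "\<And>l P Q U. open U \<Longrightarrow> (\<And>z. z \<in> U \<Longrightarrow> P + cscale_mat z Q \<in> ball A d) \<Longrightarrow>
                (\<lambda>z. E (f l (P + cscale_mat z Q))) holomorphic_on U"
    and bd: "\<And>k W. W \<in> ball A d \<Longrightarrow> norm (\<Sum>l<k. E (f l W)) \<le> B"
    and W: "W \<in> ball A d"
  shows "E W = 0"
proof -
  have B: "0 \<le> B" using bd[OF W, of 0] by simp
  have order: "norm (E W) \<le> B * (norm (W - A) / d) ^ m" if "W \<in> ball A d" for m W
    using that
  proof (induction m arbitrary: W)
    case 0
    then show ?case using bd[of W 1] by (simp add: f0)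
  next
    case (Suc m)
    \<comment> \<open>\<open>X = 0\<close> is included, so that the case \<open>W = A\<close> is covered as well.\<close>
    have on_line: "norm (E (A + cscale_mat z X)) \<le> B * (norm z / d) ^ Suc m"
      if X: "norm X \<le> 1" and z: "z \<in> ball 0 d" for X z
    proof -
      define L where "L z = A + cscale_mat z X" for z
      have LA: "norm (L z - A) \<le> norm z" for z
        using mult_left_mono[OF X, of "norm z"] by (simp add: L_def norm_cscale_mat)
      have inL: "L z \<in> ball A d" if "z \<in> ball 0 d" for z
        using that LA[of z] by (simp add: dist_norm norm_minus_commute)
      define F where "F k z = (\<Sum>l<k. E (f l (L z)))" for k z
      have holE: "(\<lambda>z. E (f l (L z))) holomorphic_on ball 0 d" for l
        unfolding L_def by (rule hol[OF open_ball]) (use inL in \<open>simp add: L_def\<close>)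
      have holF: "F k holomorphic_on ball 0 d" for k
        unfolding F_def by (intro holomorphic_intros holE)
      have holE0: "(\<lambda>z. E (L z)) holomorphic_on ball 0 d" using holE[of 0] by (simp add: f0)
      have EL: "norm (E (L z)) \<le> B * (norm z / d) ^ m" if "z \<in> ball 0 d" for z
      proof -
        have "norm (E (L z)) \<le> B * (norm (L z - A) / d) ^ m" by (rule Suc.IH[OF inL[OF that]])
        also have "\<dots> \<le> B * (norm z / d) ^ m"
          using LA[of z] d B by (intro mult_left_mono power_mono divide_right_mono) auto
        finally show ?thesis .
      qed
      \<comment> \<open>\<open>f l (L z)\<close> differs from \<open>L z\<close> by less than \<open>\<eta> |z|\<close>. The Schwarz lemma on the unit disc in
        the direction of this difference, scaled to length at most \<open>|z|\<close>, gains the factor \<open>\<eta>\<close>.\<close>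
      have diff: "(\<lambda>z. (E (f l (L z)) - E (L z)) / z ^ m) \<midarrow>0\<rightarrow> 0" for l
      proof (rule tendstoI)
        fix e :: real assume e: "0 < e"
        define C where "C = 2 * B * (2 / d) ^ m"
        have C: "0 \<le> C" using B d by (simp add: C_def)
        define \<eta> where "\<eta> = min (1 / 2) (e / (2 * (C + 1)))"
        have \<eta>: "0 < \<eta>" "\<eta> < 1" using e C by (auto simp: \<eta>_def)
        have C\<eta>: "C * \<eta> < e"
        proof -
          have "C * \<eta> \<le> C * (e / (2 * (C + 1)))" using C by (intro mult_left_mono) (auto simp: \<eta>_def)
          also have "\<dots> < e"
          proof -
            have "0 < C * e + e * 2" by (intro add_nonneg_pos mult_nonneg_nonneg) (use C e in auto)
            then show ?thesis using C by (simp add: field_simps)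
          qed
          finally show ?thesis .
        qed
        obtain r where r: "r > 0"
          "\<And>Y. norm (Y - A) < r \<Longrightarrow> norm (f l Y - f l A - (Y - A)) \<le> \<eta> * norm (Y - A)"
          using der[of l] \<eta>(1) unfolding has_derivative_at_alt by (auto simp: id_def)
        have main: "norm ((E (f l (L z)) - E (L z)) / z ^ m) < e"
          if z: "z \<noteq> 0" "norm z < min r (d / 2)" for z
        proof -
          have zd: "z \<in> ball 0 d" using z d by simp
          define Y where "Y = cscale_mat (1 / (of_real \<eta> * z)) (f l (L z) - L z)"
          have "norm (f l (L z) - L z) \<le> \<eta> * norm (L z - A)"
            using r(2)[of "L z"] LA[of z] z by (simp add: fA algebra_simps)
          also have "\<dots> \<le> \<eta> * norm z" using LA[of z] \<eta> by simp
          finally have Y1: "norm Y \<le> 1"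
            using \<eta> z by (simp add: Y_def norm_cscale_mat norm_divide norm_mult field_simps)
          have fl: "f l (L z) = L z + cscale_mat (of_real \<eta>) (cscale_mat z Y)"
            using \<eta> z by (simp add: Y_def cscale_mat_simps)
          have inb: "L z + cscale_mat s (cscale_mat z Y) \<in> ball A d"
            "norm (L z + cscale_mat s (cscale_mat z Y) - A) \<le> 2 * norm z" if "norm s < 1" for s
          proof -
            have "norm s * (norm z * norm Y) \<le> 1 * (norm z * 1)"
              using that Y1 by (intro mult_mono) auto
            then have "norm (cscale_mat s (cscale_mat z Y)) \<le> norm z" by (simp add: norm_cscale_mat)
            then show 1: "norm (L z + cscale_mat s (cscale_mat z Y) - A) \<le> 2 * norm z"
              using norm_triangle_ineq[of "L z - A" "cscale_mat s (cscale_mat z Y)"] LA[of z]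
              by (simp add: algebra_simps)
            show "L z + cscale_mat s (cscale_mat z Y) \<in> ball A d"
              using 1 z by (simp add: dist_norm norm_minus_commute)
          qed
          define \<phi> where "\<phi> s = E (L z + cscale_mat s (cscale_mat z Y)) - E (L z)" for s
          have hol\<phi>: "\<phi> holomorphic_on ball 0 1"
            unfolding \<phi>_def using hol[of "ball 0 1" "L z" "cscale_mat z Y" 0] inb(1)
            by (intro holomorphic_intros) (simp add: f0)
          have "norm (\<phi> (of_real \<eta>)) \<le> 2 * (B * (2 * norm z / d) ^ m) * (norm (of_real \<eta> :: complex) / 1)"
          proof (rule Schwarz_ball[OF hol\<phi>])
            show "\<phi> 0 = 0" by (simp add: \<phi>_def cscale_mat_simps)
            fix s :: complex assume "s \<in> ball 0 1"
            then have s: "norm s < 1" by simp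
            have "norm (E (L z + cscale_mat s (cscale_mat z Y))) \<le>
                B * (norm (L z + cscale_mat s (cscale_mat z Y) - A) / d) ^ m"
              by (rule Suc.IH[OF inb(1)[OF s]])
            also have "\<dots> \<le> B * (2 * norm z / d) ^ m"
              using inb(2)[OF s] d B by (intro mult_left_mono power_mono divide_right_mono) auto
            finally have 1: "norm (E (L z + cscale_mat s (cscale_mat z Y))) \<le> B * (2 * norm z / d) ^ m" .
            have "norm (E (L z)) \<le> B * (norm z / d) ^ m" by (rule EL[OF zd])
            also have "\<dots> \<le> B * (2 * norm z / d) ^ m"
              using d B by (intro mult_left_mono power_mono divide_right_mono) auto
            finally show "norm (\<phi> s) \<le> 2 * (B * (2 * norm z / d) ^ m)"
              using 1 norm_triangle_ineq4[of "E (L z + cscale_mat s (cscale_mat z Y))" "E (L z)"]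
              by (simp add: \<phi>_def)
          qed (use \<eta> in auto)
          then have "norm (E (f l (L z)) - E (L z)) \<le> C * \<eta> * norm z ^ m"
            using \<eta> by (simp add: fl \<phi>_def C_def power_mult_distrib power_divide mult_ac)
          then have "norm ((E (f l (L z)) - E (L z)) / z ^ m) \<le> C * \<eta>"
            using z by (simp add: norm_divide norm_power pos_divide_le_eq)
          with C\<eta> show ?thesis by linarith
        qed
        show "\<forall>\<^sub>F z in at 0. dist ((E (f l (L z)) - E (L z)) / z ^ m) 0 < e"
          unfolding eventually_at using main r(1) d
          by (intro exI[of _ "min r (d / 2)"]) auto
      qed
      have sumdiff: "(\<lambda>z. (F k z - of_nat k * E (L z)) / z ^ m) \<midarrow>0\<rightarrow> 0" for k
      proof -
        have "(\<lambda>z. \<Sum>l<k. (E (f l (L z)) - E (L z)) / z ^ m) \<midarrow>0\<rightarrow> (\<Sum>l<k. 0)"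
          by (intro tendsto_sum diff)
        then show ?thesis by (simp add: F_def sum_subtractf flip: sum_divide_distrib)
      qed
      have near0: "\<forall>\<^sub>F z in at 0. z \<noteq> 0 \<and> z \<in> ball 0 d"
        unfolding eventually_at using d by (intro exI[of _ d]) (auto simp: dist_commute)
      have ELm: "norm (E (L z) / z ^ m) \<le> B / d ^ m" if "z \<noteq> 0 \<and> z \<in> ball 0 d" for z
        using EL[of z] that d by (simp add: norm_divide norm_power power_divide field_simps)
      have Fbig: "\<forall>\<^sub>F z in at 0. norm (F k z / z ^ m) \<le> 1 + k * (B / d ^ m)" for k
        using near0 tendstoD[OF sumdiff[of k] zero_less_one]
      proof eventually_elim
        case (elim z)
        have "norm (of_nat k * (E (L z) / z ^ m)) \<le> k * (B / d ^ m)"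
          unfolding norm_mult norm_of_nat by (rule mult_left_mono[OF ELm[OF elim(1)]]) simp
        then have "norm ((F k z - of_nat k * E (L z)) / z ^ m + of_nat k * (E (L z) / z ^ m)) \<le> 1 + k * (B / d ^ m)"
          using elim(2) by (intro norm_triangle_le add_mono) simp_all
        moreover have "F k z / z ^ m = (F k z - of_nat k * E (L z)) / z ^ m + of_nat k * (E (L z) / z ^ m)"
          by (simp add: diff_divide_distrib)
        ultimately show ?case by simp
      qed
      \<comment> \<open>The bound for the sums in terms of \<open>|z| ^ m\<close> must not depend on \<open>k\<close>. It is gained one power at a
        time from the constant bound, because each sum is of order \<open>m\<close> at \<open>0\<close>.\<close>
      have Fj: "norm (F k z) \<le> B * (norm z / d) ^ j" if "j \<le> m" "z \<in> ball 0 d" for k j z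
        using that
      proof (induction j arbitrary: z)
        case 0
        then show ?case using bd[OF inL[of z], of k] by (simp add: F_def)
      next
        case (Suc j)
        show ?case
        proof (rule Schwarz_raise_order[OF holF d])
          show "norm (F k z) \<le> B * (norm z / d) ^ j" if "z \<in> ball 0 d" for z
            using Suc that by simp
          have "(\<lambda>z::complex. z ^ (m - j)) \<midarrow>0\<rightarrow> 0 ^ (m - j)" by (intro tendsto_intros)
          moreover have "0 ^ (m - j) = (0::complex)" using Suc.prems(1) by (simp add: power_0_left)
          ultimately have z0: "(\<lambda>z::complex. z ^ (m - j)) \<midarrow>0\<rightarrow> 0" by (simp only:)
          show "(\<lambda>z. F k z / z ^ j) \<midarrow>0\<rightarrow> 0"
          proof (rule tendsto_0_le[OF z0])
            show "\<forall>\<^sub>F z in at 0. norm (F k z / z ^ j) \<le> norm (z ^ (m - j)) * (1 + k * (B / d ^ m))"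
              using near0 Fbig[of k]
            proof eventually_elim
              case (elim z)
              have "z ^ m = z ^ (m - j) * z ^ j" using Suc.prems(1) by (simp flip: power_add)
              then have "F k z / z ^ j = z ^ (m - j) * (F k z / z ^ m)" using elim by simp
              then have "norm (F k z / z ^ j) = norm (z ^ (m - j)) * norm (F k z / z ^ m)"
                by (simp only: norm_mult)
              also have "\<dots> \<le> norm (z ^ (m - j)) * (1 + k * (B / d ^ m))"
                by (rule mult_left_mono[OF elim(2) norm_ge_zero])
              finally show ?case .
            qed
          qed
        qed (use Suc in auto)
      qed
      have lim: "(\<lambda>z. E (L z) / z ^ m) \<midarrow>0\<rightarrow> 0"
      proof (rule tendstoI)
        fix e :: real assume e: "0 < e"
        obtain k :: nat where k: "(B / d ^ m + 1) / e < k" using reals_Archimedean2 by blast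
        have "(B / d ^ m + 1) / e \<ge> 0" using B d e by simp
        then have k0: "real k > 0" using k by linarith
        show "\<forall>\<^sub>F z in at 0. dist (E (L z) / z ^ m) 0 < e"
          using near0 tendstoD[OF sumdiff[of k] zero_less_one]
        proof eventually_elim
          case (elim z)
          have "norm (F k z / z ^ m) \<le> B / d ^ m"
            using Fj[of m z k] elim(1) d by (simp add: norm_divide norm_power power_divide field_simps)
          moreover have "of_nat k * (E (L z) / z ^ m) = F k z / z ^ m - (F k z - of_nat k * E (L z)) / z ^ m"
            by (simp add: diff_divide_distrib)
          ultimately have "norm (of_nat k * (E (L z) / z ^ m)) \<le> B / d ^ m + 1"
            using elim(2) norm_triangle_ineq4[of "F k z / z ^ m" "(F k z - of_nat k * E (L z)) / z ^ m"]
            by simp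
          then have "k * norm (E (L z) / z ^ m) \<le> B / d ^ m + 1" by (simp only: norm_mult norm_of_nat)
          also have "\<dots> < k * e" using k e by (simp add: pos_divide_less_eq)
          finally show ?case using k0 by (simp only: mult_less_cancel_left_pos dist_norm diff_0_right)
        qed
      qed
      from Schwarz_raise_order[OF holE0 d EL lim z] show ?thesis by (simp add: L_def)
    qed
    show ?case
    proof (cases "W = A")
      case True
      then show ?thesis using on_line[of 0 0] d by (simp add: cscale_mat_simps)
    next
      case False
      define c :: complex where "c = of_real (norm (W - A))"
      have c: "c \<noteq> 0" "norm c = norm (W - A)" using False by (auto simp: c_def)
      define X where "X = cscale_mat (1 / c) (W - A)"
      have "W = A + cscale_mat c X" using c by (simp add: X_def cscale_mat_simps)
      moreover have "norm X \<le> 1" using c by (simp add: X_def norm_cscale_mat norm_divide)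
      moreover have "c \<in> ball 0 d" using c Suc.prems by (simp add: dist_norm norm_minus_commute)
      ultimately show ?thesis using on_line[of X c] c by simp
    qed
  qed
  define t where "t = norm (W - A) / d"
  have t: "0 \<le> t" "t < 1" using W d by (auto simp: t_def dist_norm norm_minus_commute)
  have "(\<lambda>m. B * t ^ m) \<longlonglongrightarrow> B * 0" using t by (intro tendsto_intros LIMSEQ_power_zero) auto
  then have "norm (E W) \<le> B * 0"
    by (rule LIMSEQ_le_const) (use order[OF W] in \<open>auto simp: t_def\<close>)
  then show ?thesis by simp
qed

text \<open>
  The sum of \<open>E\<close> over an orbit of length \<open>k\<close> telescopes to the difference of the values at its ends.
\<close>

lemma char_poly_preserved_near_fixed_point:
  fixes \<Psi> :: "'n::finite cmat \<Rightarrow> 'n cmat"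
  assumes \<Omega>: "open \<Omega>" and T: "finite T" "card T = 2 * CARD('n)" "T \<inter> \<Omega> = {}"
    and hol: "\<Psi> holomorphic_map_on spectral_set \<Omega>" and maps: "\<Psi> \<in> spectral_set \<Omega> \<rightarrow> spectral_set \<Omega>"
    and A: "A \<in> spectral_set \<Omega>" "\<Psi> A = A" "(\<Psi> has_derivative id) (at A)"
  obtains d where "0 < d" "ball A d \<subseteq> spectral_set \<Omega>"
    "\<And>W a. W \<in> ball A d \<Longrightarrow> a \<in> T \<Longrightarrow> poly (char_poly (\<Psi> W)) a = poly (char_poly W) a"
proof -
  let ?S = "spectral_set \<Omega> :: 'n cmat set"
  have S: "open ?S" by (rule open_spectral_set[OF \<Omega>])
  obtain r where r: "0 < r" "ball A r \<subseteq> ?S" using S A(1) open_contains_ball by blast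
  have it: "(\<Psi> ^^ k) holomorphic_map_on ?S" "(\<Psi> ^^ k) \<in> ?S \<rightarrow> ?S" for k
    using holomorphic_map_funpow[OF hol S maps] by auto
  have mapk: "(\<Psi> ^^ k) W \<in> ?S" if "W \<in> ?S" for k W using it(2)[of k] that by blast
  have fixA: "(\<Psi> ^^ k) A = A" for k by (induction k) (auto simp: A)
  have der: "((\<Psi> ^^ k) has_derivative id) (at A)" for k
  proof (induction k)
    case 0
    have "((\<lambda>x. x) has_derivative (\<lambda>x. x)) (at A)" by (rule has_derivative_ident)
    then show ?case by (simp add: id_def)
  next
    case (Suc k)
    have "(\<Psi> has_derivative id) (at ((\<Psi> ^^ k) A))" using A(3) by (simp add: fixA)
    from has_derivative_compose[OF Suc this] show ?case by (simp add: o_def id_def)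
  qed
  obtain M where M: "\<And>k W a. W \<in> ball A (r / 4) \<Longrightarrow> a \<in> T \<Longrightarrow> norm (poly (char_poly ((\<Psi> ^^ k) W)) a) \<le> M"
    using char_poly_values_uniformly_bounded[OF T S, where \<Phi> = "\<lambda>k. \<Psi> ^^ k", OF it(1) mapk fixA r] by blast
  have sub: "ball A (r / 4) \<subseteq> ?S" using r by (auto intro: order_trans[OF subset_ball])
  show ?thesis
  proof (rule that[OF _ sub])
    fix W a assume W: "W \<in> ball A (r / 4)" and a: "a \<in> T"
    define E where "E W = poly (char_poly (\<Psi> W)) a - poly (char_poly W) a" for W
    have "E W = 0"
    proof (rule vanishing_of_bounded_orbit_sums[where f = "\<lambda>l. \<Psi> ^^ l" and B = "2 * M" and E = E, OF _ _ der fixA _ _ W])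
      show "(\<lambda>z. E ((\<Psi> ^^ l) (P + cscale_mat z Q))) holomorphic_on U"
        if "open U" "\<And>z. z \<in> U \<Longrightarrow> P + cscale_mat z Q \<in> ball A (r / 4)" for l P Q U
      proof -
        have line: "\<And>z. z \<in> U \<Longrightarrow> P + cscale_mat z Q \<in> ?S" using that(2) sub by blast
        show ?thesis unfolding E_def
          using holomorphic_on_char_poly_along_line[OF it(1)[of "Suc l"] S that(1) line]
            holomorphic_on_char_poly_along_line[OF it(1)[of l] S that(1) line]
          by (intro holomorphic_on_diff) auto
      qed
      show "norm (\<Sum>l<k. E ((\<Psi> ^^ l) V)) \<le> 2 * M" if V: "V \<in> ball A (r / 4)" for k V
      proof -
        have "(\<Sum>l<k. E ((\<Psi> ^^ l) V)) = poly (char_poly ((\<Psi> ^^ k) V)) a - poly (char_poly V) a"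
          by (induction k) (auto simp: E_def)
        also have "norm \<dots> \<le> M + M"
          using M[OF V a, of k] M[OF V a, of 0] by (intro norm_triangle_le_diff add_mono) auto
        finally show ?thesis by simp
      qed
    qed (use r in auto)
    then show "poly (char_poly (\<Psi> W)) a = poly (char_poly W) a" by (simp add: E_def)
  qed (use r in auto)
qed

text \<open>
  The identity theorem, reduced to one variable: inside a ball, any point of a smaller open set on which
  \<open>E\<close> vanishes can be joined to any other point by a complex line.
\<close>

lemma vanishing_on_connected_set:
  fixes E :: "'n::finite cmat \<Rightarrow> complex"
  assumes S: "open S" "connected S"
    and hol: "\<And>P Q U. open U \<Longrightarrow> (\<And>z. z \<in> U \<Longrightarrow> P + cscale_mat z Q \<in> S) \<Longrightarrow>
                (\<lambda>z. E (P + cscale_mat z Q)) holomorphic_on U"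
    and d: "0 < d" "ball A d \<subseteq> S" "\<And>W. W \<in> ball A d \<Longrightarrow> E W = 0" and W: "W \<in> S"
  shows "E W = 0"
proof -
  have spread: "E W = 0" if r: "ball V r \<subseteq> S" and W: "W \<in> ball V r" and Y: "Y \<in> ball V r"
    and e: "0 < e" and zero: "\<And>Z. Z \<in> ball Y e \<Longrightarrow> E Z = 0" for V r W Y e
  proof -
    define L where "L z = Y + cscale_mat z (W - Y)" for z
    define U where "U = L -` ball V r"
    have contL: "continuous_on UNIV L"
      unfolding L_def
      by (intro continuous_on_add continuous_on_const continuous_on_id
          bounded_linear.continuous_on[OF bounded_linear_cscale_mat_left])
    have U: "open U" unfolding U_def using contL open_vimage by blast
    have "convex U"
    proof (rule convexI)
      fix x y and s t :: real assume xy: "x \<in> U" "y \<in> U" and st: "0 \<le> s" "0 \<le> t" "s + t = 1"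
      have "L (s *\<^sub>R x + t *\<^sub>R y) = s *\<^sub>R L x + t *\<^sub>R L y"
      proof -
        have lin: "cscale_mat (s *\<^sub>R x + t *\<^sub>R y) (W - Y) =
            s *\<^sub>R cscale_mat x (W - Y) + t *\<^sub>R cscale_mat y (W - Y)"
          by (simp add: linear_simps[OF bounded_linear_cscale_mat_left])
        have "Y = s *\<^sub>R Y + t *\<^sub>R Y" using st(3) by (simp flip: scaleR_add_left)
        then show ?thesis unfolding L_def lin scaleR_add_right by (metis (no_types, lifting) add.assoc add.left_commute)
      qed
      then show "s *\<^sub>R x + t *\<^sub>R y \<in> U"
        using convexD[OF convex_ball[of V r] _ _ st] xy by (simp add: U_def)
    qed
    then have conn: "connected U" by (rule convex_connected)
    have holE: "(\<lambda>z. E (L z)) holomorphic_on U"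
      unfolding L_def by (rule hol[OF U]) (use r in \<open>auto simp: U_def L_def\<close>)
    have U0: "open (U \<inter> L -` ball Y e)" using U contL open_vimage by blast
    have "0 \<in> U \<inter> L -` ball Y e" using Y e by (simp add: U_def L_def cscale_mat_simps)
    then have "U \<inter> L -` ball Y e \<noteq> {}" by blast
    moreover have "1 \<in> U" using W by (simp add: U_def L_def cscale_mat_simps)
    ultimately have "E (L 1) = 0"
      using analytic_continuation_open[OF U0 U _ conn _ holE, of "\<lambda>_. 0" 1] zero by auto
    then show ?thesis by (simp add: L_def cscale_mat_simps)
  qed
  define Z where "Z = {V \<in> S. \<exists>e>0. ball V e \<subseteq> S \<and> (\<forall>Y\<in>ball V e. E Y = 0)}"
  have "open Z"
    unfolding open_contains_ball
  proof
    fix V assume "V \<in> Z"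
    then obtain e where e: "e > 0" "ball V e \<subseteq> S" "\<And>Y. Y \<in> ball V e \<Longrightarrow> E Y = 0" by (auto simp: Z_def)
    have "ball V e \<subseteq> Z"
    proof
      fix Y assume Y: "Y \<in> ball V e"
      then obtain e' where e': "e' > 0" "ball Y e' \<subseteq> ball V e" by (meson open_ball open_contains_ball)
      have "ball Y e' \<subseteq> S" "\<forall>X\<in>ball Y e'. E X = 0" "Y \<in> S" using e'(2) e(2,3) Y by blast+
      then show "Y \<in> Z" using e'(1) unfolding Z_def by blast
    qed
    then show "\<exists>e>0. ball V e \<subseteq> Z" using e(1) by blast
  qed
  have "open (S - Z)"
    unfolding open_contains_ball
  proof
    fix V assume V: "V \<in> S - Z"
    then obtain r where r: "r > 0" "ball V r \<subseteq> S" using S(1) open_contains_ball by blast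
    have "Y \<notin> Z" if Y: "Y \<in> ball V r" for Y
    proof
      assume "Y \<in> Z"
      then obtain e where "e > 0" "\<And>X. X \<in> ball Y e \<Longrightarrow> E X = 0" by (auto simp: Z_def)
      then have "\<forall>X\<in>ball V r. E X = 0" using spread[OF r(2) _ Y] by blast
      then show False using V r by (auto simp: Z_def)
    qed
    then show "\<exists>e>0. ball V e \<subseteq> S - Z" using r by blast
  qed
  moreover have "A \<in> Z" using d by (auto simp: Z_def)
  moreover have "Z \<subseteq> S" by (auto simp: Z_def)
  ultimately have "S - Z = {}"
    using connectedD[OF S(2) \<open>open Z\<close>, of "S - Z"] by blast
  then obtain e where "e > 0" "\<forall>Y\<in>ball W e. E Y = 0" using W by (auto simp: Z_def)
  then show ?thesis by simp
qed

theorem char_poly_preserved: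
  fixes \<Psi> :: "'n::finite cmat \<Rightarrow> 'n cmat"
  assumes \<Omega>: "open \<Omega>" "connected \<Omega>" "\<Omega> \<noteq> {}" and card: "infinite (- \<Omega>) \<or> card (- \<Omega>) \<ge> 2 * CARD('n)"
    and hol: "\<Psi> holomorphic_map_on spectral_set \<Omega>" and maps: "\<Psi> \<in> spectral_set \<Omega> \<rightarrow> spectral_set \<Omega>"
    and A: "A \<in> spectral_set \<Omega>" "\<Psi> A = A" "(\<Psi> has_derivative id) (at A)"
    and W: "W \<in> spectral_set \<Omega>"
  shows "char_poly (\<Psi> W) = char_poly W"
proof -
  let ?S = "spectral_set \<Omega> :: 'n cmat set"
  have S: "open ?S" "connected ?S" using open_spectral_set connected_spectral_set \<Omega> by auto
  obtain T where T: "T \<subseteq> - \<Omega>" "finite T" "card T = 2 * CARD('n)"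
    using card infinite_arbitrarily_large obtain_subset_with_card_n by metis
  then have T': "T \<inter> \<Omega> = {}" by blast
  obtain d where d: "0 < d" "ball A d \<subseteq> ?S"
    "\<And>W a. W \<in> ball A d \<Longrightarrow> a \<in> T \<Longrightarrow> poly (char_poly (\<Psi> W)) a = poly (char_poly W) a"
    by (rule char_poly_preserved_near_fixed_point[OF \<Omega>(1) T(2,3) T' hol maps A]) blast
  have idh: "(\<lambda>W. W) holomorphic_map_on ?S"
    using holomorphic_map_funpow[OF hol S(1) maps, of 0] by (simp add: id_def)
  have eq: "poly (char_poly (\<Psi> W)) a = poly (char_poly W) a" if a: "a \<in> T" for a
  proof -
    have "poly (char_poly (\<Psi> W)) a - poly (char_poly W) a = 0"
      by (rule vanishing_on_connected_set[OF S _ d(1,2) _ W,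
              where E = "\<lambda>W. poly (char_poly (\<Psi> W)) a - poly (char_poly W) a"])
        (use d(3) a in \<open>auto intro!: holomorphic_on_diff holomorphic_on_char_poly_along_line[OF hol S(1)]
            holomorphic_on_char_poly_along_line[OF idh S(1)]\<close>)
    then show ?thesis by simp
  qed
  show ?thesis
    by (rule poly_eqI_degree[of T]) (use eq T(3) in \<open>auto simp: char_poly_monic(1)\<close>)
qed

theorem theorem1p2:
  fixes \<Omega> :: "complex set"
    and \<Psi> :: "complex ^ 'n::finite ^ 'n \<Rightarrow> complex ^ 'n ^ 'n"
    and A :: "complex ^ 'n ^ 'n"
  assumes "CARD('n) \<ge> 2"
    and "open \<Omega>" and "connected \<Omega>" and "\<Omega> \<noteq> {}"
    and "infinite (- \<Omega>) \<or> card (- \<Omega>) \<ge> 2 * CARD('n)"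
    and "\<Psi> \<in> spectral_set \<Omega> \<rightarrow> spectral_set \<Omega>"
    and "\<Psi> holomorphic_map_on spectral_set \<Omega>"
    and "A \<in> spectral_set \<Omega>"
    and "\<Psi> A = A"
    and "(\<Psi> has_complex_derivative id) (at A within spectral_set \<Omega>)"
    and "diagonalizable A \<or> non_derogatory A"
  shows "(\<forall>W\<in>spectral_set \<Omega>. char_coeffs (\<Psi> W) = char_coeffs W) \<and>
         (\<forall>W\<in>spectral_set \<Omega>. spectrum (\<Psi> W) = spectrum W \<and>
            (\<forall>t\<in>spectrum W. alg_mult (\<Psi> W) t = alg_mult W t))"
proof -
  have "(\<Psi> has_derivative id) (at A)"
    using assms(10) at_within_open[OF assms(8) open_spectral_set[OF assms(2)]]
    by (simp add: has_complex_derivative_def)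
  from char_poly_preserved[OF assms(2-5,7,6,8,9) this]
  have "char_poly (\<Psi> W) = char_poly W" if "W \<in> spectral_set \<Omega>" for W using that .
  then show ?thesis
    by (auto simp: char_coeffs_def char_coeff_def alg_mult_def spectrum_eq_char_poly_roots)
qed

end
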